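(* There is a universal numerical constant $C>0$ such that the following holds. Let $\mathbb{K}\in\{\mathbb{R},\mathbb{C}\}$, let $N,n,m,s,\sigma$ be positive integers with $1\le s\le N$ and $1\le\sigma\le n$, and let $\delta,\epsilon\in(0,1)$. Let $A\in\mathbb{K}^{m\times Nn}$ be a random Gaussian matrix. If $$ m \;\ge\; \frac{C}{\delta^2}\left( s\log\left(\frac{N}{s}\right) + s\sigma\log\left(\frac{n}{\sigma}\right) + \log\left(\frac{1}{\epsilon}\right)\right), $$ then, with probability at least $1-\epsilon$, the $(s,\sigma)$-HiRIP constant of $\tfrac{1}{\sqrt{m}}A$ satisfies $$\delta_{s,\sigma}\left(\tfrac{1}{\sqrt m}A\right)\le\delta .$$
   Context: A random matrix is called Gaussian if its entries are i.i.d. distributed according to the standard normal distribution $\mathcal{N}(0,1)$. A vector $x\in\mathbb{K}^{Nn}$ is viewed as consisting of $N$ consecutive blocks $x_1,\dots,x_N\in\mathbb{K}^n$. It is called $(s,\sigma)$-sparse if at most $s$ of the blocks $x_i$ are non-zero and each non-zero block has at most $\sigma$ non-zero entries. For a linear operator $M:\mathbb{K}^{Nn}\to\mathbb{K}^m$, the $(s,\sigma)$-HiRIP (hierarchical restricted isometry property) constant $\delta_{s,\sigma}(M)$ is the smallest constant $\delta\ge 0$ such that $(1-\delta)\|x\|^2\le\|Mx\|^2\le(1+\delta)\|x\|^2$ for all $(s,\sigma)$-sparse $x\in\mathbb{K}^{Nn}$, where $\|\cdot\|$ is the Euclidean norm.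
   Formalization: The term log(n/σ) is replaced by log(en/σ): as written the claim is false, since for s=N, σ=n the bound on m does not depend on Nn, and for m<Nn the matrix has a kernel, so its HiRIP constant is at least 1. *)

theory Defs
  imports "HOL-Probability.Probability" "Jordan_Normal_Form.Matrix"
begin

no_notation vec_nth (infixl "$" 90)

definition l2_norm :: "'a::real_normed_field Matrix.vec \<Rightarrow> real" where
  "l2_norm x = L2_set (\<lambda>k. norm (x $ k)) {..<dim_vec x}"

(* The i-th of the consecutive length-n blocks; blocks are counted from 0. *)
definition block :: "nat \<Rightarrow> 'a Matrix.vec \<Rightarrow> nat \<Rightarrow> 'a Matrix.vec" where
  "block n x i = Matrix.vec n (\<lambda>j. x $ (i * n + j))"

definition hi_sparse ::
  "nat \<Rightarrow> nat \<Rightarrow> nat \<Rightarrow> nat \<Rightarrow> 'a::real_normed_field Matrix.vec \<Rightarrow> bool" where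
  "hi_sparse N n s \<sigma> x \<longleftrightarrow>
     card {i. i < N \<and> block n x i \<noteq> 0\<^sub>v n} \<le> s \<and>
     (\<forall>i<N. block n x i \<noteq> 0\<^sub>v n \<longrightarrow> card {j. j < n \<and> block n x i $ j \<noteq> 0} \<le> \<sigma>)"

definition hirip_bound ::
  "nat \<Rightarrow> nat \<Rightarrow> nat \<Rightarrow> nat \<Rightarrow> 'a::real_normed_field Matrix.mat \<Rightarrow> real \<Rightarrow> bool" where
  "hirip_bound N n s \<sigma> M \<delta> \<longleftrightarrow>
     (\<forall>x \<in> carrier_vec (N * n). hi_sparse N n s \<sigma> x \<longrightarrow>
        (1 - \<delta>) * (l2_norm x)\<^sup>2 \<le> (l2_norm (M *\<^sub>v x))\<^sup>2 \<and>
        (l2_norm (M *\<^sub>v x))\<^sup>2 \<le> (1 + \<delta>) * (l2_norm x)\<^sup>2)"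

(* The infimum is attained, see hirip_const_is_least below. *)
definition hirip_const ::
  "nat \<Rightarrow> nat \<Rightarrow> nat \<Rightarrow> nat \<Rightarrow> 'a::real_normed_field Matrix.mat \<Rightarrow> real" where
  "hirip_const N n s \<sigma> M = Inf {\<delta>. 0 \<le> \<delta> \<and> hirip_bound N n s \<sigma> M \<delta>}"

lemma hirip_bound_exists:
  fixes M :: "'a::real_normed_field Matrix.mat"
  assumes M: "M \<in> carrier_mat m (N * n)"
  shows "\<exists>\<delta>\<ge>0. hirip_bound N n s \<sigma> M \<delta>"
proof -
  define B where "B = (\<Sum>i<m. (\<Sum>k<N * n. norm (M $$ (i, k)))\<^sup>2)"
  have B0: "0 \<le> B" unfolding B_def by (intro sum_nonneg) auto
  have bd: "(l2_norm (M *\<^sub>v x))\<^sup>2 \<le> B * (l2_norm x)\<^sup>2" if x: "x \<in> carrier_vec (N * n)" for x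
  proof -
    have ent: "norm (x $ k) \<le> l2_norm x" if "k < N * n" for k
      unfolding l2_norm_def
      using member_le_L2_set[of "{..<dim_vec x}" k "\<lambda>k. norm (x $ k)"] that x by auto
    have "norm ((M *\<^sub>v x) $ i) \<le> (\<Sum>k<N * n. norm (M $$ (i, k))) * l2_norm x" if i: "i < m" for i
    proof -
      have "(M *\<^sub>v x) $ i = (\<Sum>k<N * n. M $$ (i, k) * x $ k)"
        using M x i by (auto simp: scalar_prod_def atLeast0LessThan intro!: sum.cong)
      also have "norm \<dots> \<le> (\<Sum>k<N * n. norm (M $$ (i, k)) * norm (x $ k))"
        by (rule order_trans[OF norm_sum]) (simp add: norm_mult)
      also have "\<dots> \<le> (\<Sum>k<N * n. norm (M $$ (i, k)) * l2_norm x)"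
        by (intro sum_mono mult_left_mono ent) auto
      finally show ?thesis by (simp add: sum_distrib_right)
    qed
    then have "(norm ((M *\<^sub>v x) $ i))\<^sup>2 \<le> (\<Sum>k<N * n. norm (M $$ (i, k)))\<^sup>2 * (l2_norm x)\<^sup>2"
      if "i < m" for i
      unfolding power_mult_distrib[symmetric] using that by (intro power_mono) auto
    then have "(\<Sum>i<m. (norm ((M *\<^sub>v x) $ i))\<^sup>2) \<le> B * (l2_norm x)\<^sup>2"
      unfolding B_def sum_distrib_right by (intro sum_mono) auto
    moreover have "(l2_norm (M *\<^sub>v x))\<^sup>2 = (\<Sum>i<m. (norm ((M *\<^sub>v x) $ i))\<^sup>2)"
      using M by (simp add: l2_norm_def L2_set_def sum_nonneg)
    ultimately show ?thesis by simp
  qed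
  have "hirip_bound N n s \<sigma> M (1 + B)"
    unfolding hirip_bound_def
  proof (intro ballI impI conjI)
    fix x :: "'a Matrix.vec" assume x: "x \<in> carrier_vec (N * n)"
    have "(1 - (1 + B)) * (l2_norm x)\<^sup>2 \<le> 0" using B0 by (simp add: mult_nonpos_nonneg)
    then show "(1 - (1 + B)) * (l2_norm x)\<^sup>2 \<le> (l2_norm (M *\<^sub>v x))\<^sup>2"
      by (rule order_trans) simp
    have "B * (l2_norm x)\<^sup>2 \<le> (1 + (1 + B)) * (l2_norm x)\<^sup>2"
      by (intro mult_right_mono) auto
    then show "(l2_norm (M *\<^sub>v x))\<^sup>2 \<le> (1 + (1 + B)) * (l2_norm x)\<^sup>2"
      using bd[OF x] by linarith
  qed
  then show ?thesis using B0 by (intro exI[of _ "1 + B"]) auto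
qed

lemma hirip_const_is_least:
  fixes M :: "'a::real_normed_field Matrix.mat"
  assumes M: "M \<in> carrier_mat m (N * n)"
  shows "0 \<le> hirip_const N n s \<sigma> M"
    and "hirip_bound N n s \<sigma> M (hirip_const N n s \<sigma> M)"
    and "0 \<le> \<delta> \<Longrightarrow> hirip_bound N n s \<sigma> M \<delta> \<Longrightarrow> hirip_const N n s \<sigma> M \<le> \<delta>"
proof -
  let ?D = "{\<delta>. 0 \<le> \<delta> \<and> hirip_bound N n s \<sigma> M \<delta>}"
  have ne: "?D \<noteq> {}" using hirip_bound_exists[OF M] by auto
  have bb: "bdd_below ?D" by (rule bdd_belowI[of _ 0]) auto
  show "0 \<le> hirip_const N n s \<sigma> M"
    unfolding hirip_const_def using ne by (intro cInf_greatest) auto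
  show "0 \<le> \<delta> \<Longrightarrow> hirip_bound N n s \<sigma> M \<delta> \<Longrightarrow> hirip_const N n s \<sigma> M \<le> \<delta>"
    unfolding hirip_const_def using bb by (intro cInf_lower) auto
  have "closed ?D"
    unfolding hirip_bound_def Ball_def
    by (intro closed_Collect_conj closed_Collect_all closed_Collect_imp open_Collect_const
        closed_Collect_le continuous_intros)
  then have "Inf ?D \<in> ?D" using ne bb by (intro closed_contains_Inf) auto
  then show "hirip_bound N n s \<sigma> M (hirip_const N n s \<sigma> M)"
    unfolding hirip_const_def by simp
qed

definition std_normal :: "real measure" where
  "std_normal = density lborel std_normal_density"

(* For complex matrices, "standard normal entries" has two usual readings: real N(0,1) entries
   regarded as complex numbers, and circularly symmetric complex N(0,1) entries, whose real and
   imaginary parts are independent N(0,1/2). *)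
definition std_normal_of_real :: "complex measure" where
  "std_normal_of_real = distr std_normal borel complex_of_real"

definition complex_std_normal :: "complex measure" where
  "complex_std_normal =
     distr (std_normal \<Otimes>\<^sub>M std_normal) borel (\<lambda>(u, v). Complex (u / sqrt 2) (v / sqrt 2))"

(* The law of an m x d matrix with i.i.d. entries of law \<mu>, as a measure on index functions;
   a sample A is turned into a matrix by Matrix.mat m d A. *)
definition iid_entries :: "'a measure \<Rightarrow> nat \<Rightarrow> nat \<Rightarrow> (nat \<times> nat \<Rightarrow> 'a) measure" where
  "iid_entries \<mu> m d = PiM ({..<m} \<times> {..<d}) (\<lambda>_. \<mu>)"

end

(* Every (s,\<sigma>)-sparse vector is supported on one of at most (N choose s) (n choose \<sigma>)^s coordinate sets
   T of size at most k = s\<sigma>. On such a T put q(x) = |Ax|^2 - m |x|^2. Rescaling x to squared norm 32k and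
   truncating real and imaginary parts to integers yields a net that is scale free and has at most
   2304^k points. By polarization, passing from x to its truncation changes q by at most 16k times the
   supremum of |q(x)| / |x|^2, so |q(x)| <= 2 \<alpha> |x|^2 follows once |q(w)| <= \<alpha> |w|^2 on the net.
   For fixed w, the real and imaginary parts of the rows of Aw give two sums of m independent squared
   Gaussians each, whose deviations are bounded by Chernoff's method; the two parts need not be
   independent of each other. A union bound over T and w concludes. Real matrices are treated by
   letting them act on complex vectors. *)
theory Submission
  imports Defs
begin

subsection \<open>Reduction of the quadratic form to a lattice net\<close>

text \<open>A lattice replaces the usual covering of the unit sphere because its points can be
  counted by a geometric series, without comparing volumes. Its radius is free: both the condition
  on the net and the tail bound for a fixed w concern the deviation relative to |w|^2. At squared
  norm 32k the truncation error is at most 2k, hence a fixed fraction of the squared norm in every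
  dimension; this is what lets the comparison with the supremum contract by 1/2. The obstacle in
  treating all entry laws at once is that the real and imaginary parts of a coordinate of Aw behave
  differently: for real entries their variances depend on w and they may be correlated, for circular
  entries both variances are |w|^2 / 2. The argument asks only that each part be a centred Gaussian,
  possibly degenerate, and that the two variances add up to |w|^2. Since ln (e n / \<sigma>) is at
  least 1, the term s\<sigma> ln (e n / \<sigma>) absorbs every factor exponential in k = s\<sigma>:
  the size of the net as well as the powers of e lost in bounding the binomial coefficients.\<close>

definition quad_defect :: "nat \<Rightarrow> 'j set \<Rightarrow> (nat \<Rightarrow> 'j \<Rightarrow> complex) \<Rightarrow> ('j \<Rightarrow> complex) \<Rightarrow> real" where
  "quad_defect m T a x =
     (\<Sum>i<m. (cmod (\<Sum>j\<in>T. a i j * x j))\<^sup>2) - real m * (\<Sum>j\<in>T. (cmod (x j))\<^sup>2)"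

lemma quad_defect_scale:
  "quad_defect m T a (\<lambda>j. of_real c * x j) = c\<^sup>2 * quad_defect m T a x"
proof -
  have "(\<Sum>j\<in>T. a i j * (of_real c * x j)) = of_real c * (\<Sum>j\<in>T. a i j * x j)" for i
    by (simp add: sum_distrib_left algebra_simps)
  then show ?thesis
    by (simp add: quad_defect_def norm_mult power_mult_distrib sum_distrib_left[symmetric]
        right_diff_distrib mult.left_commute)
qed

text \<open>Polarization of the product of p - r and p + r. The factor \<open>t\<close> cancels in
  that product, but it can be chosen to balance a small difference against a large sum.\<close>

lemma cmod_sq_diff_polar:
  fixes p r :: complex and t :: real
  assumes "t \<noteq> 0"
  shows "(cmod p)\<^sup>2 - (cmod r)\<^sup>2 =
    ((cmod (t *\<^sub>R (p - r) + (p + r) /\<^sub>R t))\<^sup>2 - (cmod (t *\<^sub>R (p - r) - (p + r) /\<^sub>R t))\<^sup>2) / 4"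
proof -
  have *: "(t * (a - b) + inverse t * (a + b))\<^sup>2 - (t * (a - b) - inverse t * (a + b))\<^sup>2
    = 4 * (a\<^sup>2 - b\<^sup>2)" for a b :: real
  proof -
    have "(t * (a - b) + inverse t * (a + b))\<^sup>2 - (t * (a - b) - inverse t * (a + b))\<^sup>2
       = 4 * ((t * inverse t) * ((a - b) * (a + b)))"
      by (simp add: power2_eq_square algebra_simps)
    also have "\<dots> = 4 * (a\<^sup>2 - b\<^sup>2)" using assms by (simp add: power2_eq_square algebra_simps)
    finally show ?thesis .
  qed
  show ?thesis using *[of "Re p" "Re r"] *[of "Im p" "Im r"] by (simp add: cmod_power2)
qed

text \<open>Both sums in the defect are squared moduli of linear functions of the vector, so the
  scalar identity applies to each summand.\<close>

lemma quad_defect_polar: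
  assumes "t \<noteq> 0"
  shows "quad_defect m T a x - quad_defect m T a z =
    (quad_defect m T a (\<lambda>j. t *\<^sub>R (x j - z j) + (x j + z j) /\<^sub>R t) -
     quad_defect m T a (\<lambda>j. t *\<^sub>R (x j - z j) - (x j + z j) /\<^sub>R t)) / 4"
proof -
  define A where "A x i = (\<Sum>j\<in>T. a i j * x j)" for x :: "'a \<Rightarrow> complex" and i
  have l1: "A (\<lambda>j. t *\<^sub>R (x j - z j) + (x j + z j) /\<^sub>R t) i
     = t *\<^sub>R (A x i - A z i) + (A x i + A z i) /\<^sub>R t" for i
    unfolding A_def by (simp add: sum.distrib[symmetric] sum_subtractf[symmetric]
        scaleR_right.sum algebra_simps)
  have l2: "A (\<lambda>j. t *\<^sub>R (x j - z j) - (x j + z j) /\<^sub>R t) i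
     = t *\<^sub>R (A x i - A z i) - (A x i + A z i) /\<^sub>R t" for i
    unfolding A_def by (simp add: sum.distrib[symmetric] sum_subtractf[symmetric]
        scaleR_right.sum algebra_simps)
  have lin: "X - Z = (P - R) / 4 \<Longrightarrow> Y - W = (U - V) / 4 \<Longrightarrow>
      X - c * Y - (Z - c * W) = ((P - c * U) - (R - c * V)) / 4" for X Z P R Y W U V c :: real
  proof -
    assume *: "X - Z = (P - R) / 4" "Y - W = (U - V) / 4"
    have "X - c * Y - (Z - c * W) = (X - Z) - c * (Y - W)" by (simp add: algebra_simps)
    then show ?thesis unfolding * by (simp add: field_simps)
  qed
  have q: "quad_defect m T a y = (\<Sum>i<m. (cmod (A y i))\<^sup>2) - real m * (\<Sum>j\<in>T. (cmod (y j))\<^sup>2)" for y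
    by (simp add: quad_defect_def A_def)
  have "(\<Sum>i<m. (cmod (A x i))\<^sup>2) - (\<Sum>i<m. (cmod (A z i))\<^sup>2)
    = ((\<Sum>i<m. (cmod (A (\<lambda>j. t *\<^sub>R (x j - z j) + (x j + z j) /\<^sub>R t) i))\<^sup>2)
     - (\<Sum>i<m. (cmod (A (\<lambda>j. t *\<^sub>R (x j - z j) - (x j + z j) /\<^sub>R t) i))\<^sup>2)) / 4"
    unfolding l1 l2 sum_subtractf[symmetric] sum_divide_distrib
    by (intro sum.cong refl cmod_sq_diff_polar assms)
  moreover have "(\<Sum>j\<in>T. (cmod (x j))\<^sup>2) - (\<Sum>j\<in>T. (cmod (z j))\<^sup>2)
    = ((\<Sum>j\<in>T. (cmod (t *\<^sub>R (x j - z j) + (x j + z j) /\<^sub>R t))\<^sup>2)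
     - (\<Sum>j\<in>T. (cmod (t *\<^sub>R (x j - z j) - (x j + z j) /\<^sub>R t))\<^sup>2)) / 4"
    unfolding sum_subtractf[symmetric] sum_divide_distrib
    by (intro sum.cong refl cmod_sq_diff_polar assms)
  ultimately show ?thesis unfolding q by (rule lin)
qed

text \<open>Cauchy-Schwarz in each row. The size of the bound is irrelevant: it only provides a
  finite starting value for the iteration in \<open>quad_defect_le_of_net\<close>.\<close>

lemma quad_defect_bounded:
  assumes "finite T"
  shows "\<exists>S\<ge>0. \<forall>x. \<bar>quad_defect m T a x\<bar> \<le> S * (\<Sum>j\<in>T. (cmod (x j))\<^sup>2)"
proof (intro exI conjI allI)
  let ?S = "(\<Sum>i<m. \<Sum>j\<in>T. (cmod (a i j))\<^sup>2) + real m"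
  show "0 \<le> ?S" by (intro add_nonneg_nonneg sum_nonneg) auto
  fix x :: "'a \<Rightarrow> complex"
  have "(cmod (\<Sum>j\<in>T. a i j * x j))\<^sup>2 \<le> (\<Sum>j\<in>T. (cmod (a i j))\<^sup>2) * (\<Sum>j\<in>T. (cmod (x j))\<^sup>2)" for i
  proof -
    have "(cmod (\<Sum>j\<in>T. a i j * x j))\<^sup>2 \<le> (\<Sum>j\<in>T. cmod (a i j) * cmod (x j))\<^sup>2"
      by (intro power_mono order_trans[OF norm_sum]) (auto simp: norm_mult)
    also have "\<dots> \<le> (\<Sum>j\<in>T. (cmod (a i j))\<^sup>2) * (\<Sum>j\<in>T. (cmod (x j))\<^sup>2)"
      by (rule Cauchy_Schwarz_ineq_sum)
    finally show ?thesis .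
  qed
  then have "(\<Sum>i<m. (cmod (\<Sum>j\<in>T. a i j * x j))\<^sup>2)
     \<le> (\<Sum>i<m. \<Sum>j\<in>T. (cmod (a i j))\<^sup>2) * (\<Sum>j\<in>T. (cmod (x j))\<^sup>2)"
    unfolding sum_distrib_right by (intro sum_mono) (simp add: sum_distrib_right)
  moreover have "0 \<le> (\<Sum>i<m. (cmod (\<Sum>j\<in>T. a i j * x j))\<^sup>2)" by (intro sum_nonneg) auto
  moreover have "0 \<le> real m * (\<Sum>j\<in>T. (cmod (x j))\<^sup>2)" by (intro mult_nonneg_nonneg sum_nonneg) auto
  ultimately show "\<bar>quad_defect m T a x\<bar> \<le> ?S * (\<Sum>j\<in>T. (cmod (x j))\<^sup>2)"
    unfolding quad_defect_def distrib_right by linarith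
qed

text \<open>Gaussian integers indexed by their real coordinates: the flag \<open>True\<close>
  selects the real part, \<open>False\<close> the imaginary part. Points over \<open>T\<close> thus
  become integer vectors with 2 * \<open>card T\<close> coordinates, and weights on them can
  factorise over coordinates.\<close>

definition gauss_int :: "('j \<times> bool \<Rightarrow> int) \<Rightarrow> 'j \<Rightarrow> complex" where
  "gauss_int f j = Complex (of_int (f (j, True))) (of_int (f (j, False)))"

definition lattice_net :: "'j set \<Rightarrow> nat \<Rightarrow> ('j \<times> bool \<Rightarrow> int) set" where
  "lattice_net T L =
     {f \<in> PiE (T \<times> UNIV) (\<lambda>_. {- int L..int L}). (\<Sum>e\<in>T \<times> UNIV. \<bar>f e\<bar>) \<le> int L}"

lemma finite_lattice_net: "finite T \<Longrightarrow> finite (lattice_net T L)"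
  unfolding lattice_net_def by (rule finite_subset[of _ "PiE (T \<times> UNIV) (\<lambda>_. {- int L..int L})"])
    (auto intro!: finite_PiE)

text \<open>A two-sided geometric series, below 3 for every \<open>L\<close>. Each real coordinate
  contributes one such factor, hence 9 for each complex coordinate.\<close>

lemma sum_half_power_abs:
  "(\<Sum>z\<in>{- int L..int L}. (1/2::real) ^ nat \<bar>z\<bar>) = 3 - 2 * (1/2) ^ L"
proof (induction L)
  case (Suc L)
  have "{- int (Suc L)..int (Suc L)} = insert (- int (Suc L)) (insert (int (Suc L)) {- int L..int L})"
    by auto
  then show ?case using Suc by (simp add: nat_add_distrib)
qed simp

text \<open>Each lattice point of \<open>\<ell>\<^sub>1\<close>-norm at most \<open>L\<close> is counted with weight \<open>2\<close> to the power
  \<open>L\<close> minus its norm, which is at least 1; without the norm constraint the weights factorise.\<close>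
lemma card_lattice_net:
  assumes "finite T"
  shows "real (card (lattice_net T L)) \<le> 2 ^ L * 9 ^ card T"
proof -
  let ?E = "T \<times> (UNIV :: bool set)" and ?P = "PiE (T \<times> (UNIV :: bool set)) (\<lambda>_. {- int L..int L})"
  have fE: "finite ?E" using assms by simp
  have "1 \<le> 2 ^ L * (\<Prod>e\<in>?E. (1/2::real) ^ nat \<bar>f e\<bar>)" if "f \<in> lattice_net T L" for f
  proof -
    have "int (\<Sum>e\<in>?E. nat \<bar>f e\<bar>) = (\<Sum>e\<in>?E. \<bar>f e\<bar>)" by simp
    also have "\<dots> \<le> int L" using that by (simp add: lattice_net_def)
    finally have "(\<Sum>e\<in>?E. nat \<bar>f e\<bar>) \<le> L" by (simp only: of_nat_le_iff)
    then have "(1/2::real) ^ L \<le> (1/2) ^ (\<Sum>e\<in>?E. nat \<bar>f e\<bar>)"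
      by (intro power_decreasing) auto
    then have "2 ^ L * (1/2::real) ^ L \<le> 2 ^ L * (1/2) ^ (\<Sum>e\<in>?E. nat \<bar>f e\<bar>)"
      by (intro mult_left_mono) auto
    then show ?thesis by (simp add: power_sum power_mult_distrib[symmetric])
  qed
  then have "real (card (lattice_net T L))
    \<le> (\<Sum>f\<in>lattice_net T L. 2 ^ L * (\<Prod>e\<in>?E. (1/2::real) ^ nat \<bar>f e\<bar>))"
    using sum_mono[of "lattice_net T L" "\<lambda>_. 1::real"] by simp
  also have "\<dots> \<le> (\<Sum>f\<in>?P. 2 ^ L * (\<Prod>e\<in>?E. (1/2::real) ^ nat \<bar>f e\<bar>))"
    using fE by (intro sum_mono2 finite_PiE) (auto simp: lattice_net_def intro!: mult_nonneg_nonneg prod_nonneg)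
  also have "\<dots> = 2 ^ L * (\<Prod>e\<in>?E. \<Sum>z\<in>{- int L..int L}. (1/2::real) ^ nat \<bar>z\<bar>)"
    using fE by (subst prod_sum_PiE) (auto simp: sum_distrib_left)
  also have "\<dots> \<le> 2 ^ L * (\<Prod>e\<in>?E. 3)"
    by (intro mult_left_mono prod_mono conjI sum_nonneg) (auto simp: sum_half_power_abs)
  also have "\<dots> = 2 ^ L * 9 ^ card T"
    by (simp add: card_cartesian_product mult.commute[of _ 2] power_mult)
  finally show ?thesis .
qed

text \<open>Rounding is towards zero, not to the nearest integer, so that no coordinate grows in
  absolute value: the net point then has squared norm at most that of the vector it
  approximates.\<close>

definition trunc_int :: "real \<Rightarrow> int" where
  "trunc_int r = (if 0 \<le> r then \<lfloor>r\<rfloor> else \<lceil>r\<rceil>)"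

lemma abs_trunc_int_le: "\<bar>real_of_int (trunc_int r)\<bar> \<le> \<bar>r\<bar>"
  unfolding trunc_int_def by (auto; linarith)

lemma abs_diff_trunc_int_le: "\<bar>r - real_of_int (trunc_int r)\<bar> \<le> 1"
  unfolding trunc_int_def by (auto; linarith)

text \<open>Each of the 2k real coordinates is moved by at most 1, which gives the error 2k, where k
  = \<open>card T\<close>. The radius 8k of the net comes from trading the Euclidean norm for the l1
  norm coordinate by coordinate: 32k / 8 + 2 * 2k = 8k.\<close>

lemma lattice_net_approx:
  fixes x :: "'j \<Rightarrow> complex"
  assumes T: "finite T" and x: "(\<Sum>j\<in>T. (cmod (x j))\<^sup>2) = 32 * real (card T)"
  shows "\<exists>f\<in>lattice_net T (8 * card T).
    (\<Sum>j\<in>T. (cmod (gauss_int f j))\<^sup>2) \<le> 32 * real (card T) \<and>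
    (\<Sum>j\<in>T. (cmod (x j - gauss_int f j))\<^sup>2) \<le> 2 * real (card T)"
proof -
  let ?E = "T \<times> (UNIV :: bool set)"
  define c where "c e = (if snd e then Re (x (fst e)) else Im (x (fst e)))" for e :: "'j \<times> bool"
  define f where "f = (\<lambda>e\<in>?E. trunc_int (c e))"
  have sumE: "(\<Sum>e\<in>?E. g e) = (\<Sum>j\<in>T. g (j, True) + g (j, False))" for g :: "_ \<Rightarrow> real"
    by (simp add: sum.cartesian_product' UNIV_bool add.commute)
  have sq: "(real_of_int (trunc_int r))\<^sup>2 \<le> r\<^sup>2" for r
    using abs_trunc_int_le[of r] by (simp add: abs_le_square_iff)
  have sq1: "(r - real_of_int (trunc_int r))\<^sup>2 \<le> 1" for r
    using abs_diff_trunc_int_le[of r] by (simp add: abs_square_le_1)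
  have g: "gauss_int f j = Complex (trunc_int (Re (x j))) (trunc_int (Im (x j)))" if "j \<in> T" for j
    using that by (simp add: gauss_int_def f_def c_def)
  have n1: "(\<Sum>j\<in>T. (cmod (gauss_int f j))\<^sup>2) \<le> 32 * real (card T)"
    unfolding x[symmetric] by (intro sum_mono) (auto simp: g cmod_power2 intro!: add_mono sq)
  have "(\<Sum>j\<in>T. (cmod (x j - gauss_int f j))\<^sup>2) \<le> (\<Sum>j\<in>T. 1 + 1)"
  proof (intro sum_mono)
    fix j assume "j \<in> T"
    then show "(cmod (x j - gauss_int f j))\<^sup>2 \<le> 1 + 1"
      using add_mono[OF sq1[of "Re (x j)"] sq1[of "Im (x j)"]] by (simp add: g cmod_power2)
  qed
  then have n2: "(\<Sum>j\<in>T. (cmod (x j - gauss_int f j))\<^sup>2) \<le> 2 * real (card T)" by simp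
  have "(\<Sum>e\<in>?E. \<bar>real_of_int (f e)\<bar>) \<le> (\<Sum>e\<in>?E. (c e)\<^sup>2 / 8 + 2)"
  proof (intro sum_mono)
    fix e assume e: "e \<in> ?E"
    have "\<bar>real_of_int (f e)\<bar> \<le> \<bar>c e\<bar>" using e by (simp add: f_def abs_trunc_int_le)
    \<comment> \<open>The bound is tight at 4, the common size of the coordinates when the squared
      norm 32k is spread evenly over 2k real coordinates.\<close>
    also have "\<dots> \<le> (c e)\<^sup>2 / 8 + 2"
      using zero_le_power2[of "\<bar>c e\<bar> - 4"] by (simp add: power2_diff)
    finally show "\<bar>real_of_int (f e)\<bar> \<le> (c e)\<^sup>2 / 8 + 2" .
  qed
  also have "\<dots> = (\<Sum>j\<in>T. (cmod (x j))\<^sup>2) / 8 + 4 * real (card T)"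
    unfolding sumE by (simp add: c_def cmod_power2 sum.distrib sum_divide_distrib add_divide_distrib)
  also have "\<dots> = real (8 * card T)" using x by simp
  finally have "real_of_int (\<Sum>e\<in>?E. \<bar>f e\<bar>) \<le> real_of_int (int (8 * card T))" by simp
  then have L: "(\<Sum>e\<in>?E. \<bar>f e\<bar>) \<le> int (8 * card T)" by (simp only: of_int_le_iff)
  have "f e \<in> {- int (8 * card T)..int (8 * card T)}" if e: "e \<in> ?E" for e
  proof -
    have "\<bar>f e\<bar> \<le> (\<Sum>e\<in>?E. \<bar>f e\<bar>)"
      using T e by (intro member_le_sum) auto
    then show ?thesis using L by auto
  qed
  moreover have "f \<in> extensional ?E" by (simp add: f_def)
  ultimately have "f \<in> PiE ?E (\<lambda>_. {- int (8 * card T)..int (8 * card T)})" by (rule PiE_I[OF _ extensional_arb])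
  then have "f \<in> lattice_net T (8 * card T)"
    unfolding lattice_net_def using L by blast
  then show ?thesis using n1 n2 by blast
qed

text \<open>If \<open>S\<close> is a bound on the relative defect, comparison with the net improves it to
  \<open>\<alpha> + S / 2\<close>; the best bound is therefore at most \<open>2 * \<alpha>\<close>.\<close>
lemma quad_defect_le_of_net:
  fixes a :: "nat \<Rightarrow> 'j \<Rightarrow> complex"
  assumes T: "finite T" and \<alpha>: "0 \<le> \<alpha>"
    and net: "\<And>f. f \<in> lattice_net T (8 * card T) \<Longrightarrow>
      \<bar>quad_defect m T a (gauss_int f)\<bar> \<le> \<alpha> * (\<Sum>j\<in>T. (cmod (gauss_int f j))\<^sup>2)"
  shows "\<bar>quad_defect m T a x\<bar> \<le> 2 * \<alpha> * (\<Sum>j\<in>T. (cmod (x j))\<^sup>2)"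
proof -
  define B where "B S \<longleftrightarrow> 0 \<le> S \<and> (\<forall>x. \<bar>quad_defect m T a x\<bar> \<le> S * (\<Sum>j\<in>T. (cmod (x j))\<^sup>2))" for S
  define k where "k = real (card T)"
  have improve: "B (\<alpha> + S / 2)" if S: "B S" for S
    unfolding B_def
  proof (intro conjI allI)
    have S0: "0 \<le> S" and Sb: "\<And>x. \<bar>quad_defect m T a x\<bar> \<le> S * (\<Sum>j\<in>T. (cmod (x j))\<^sup>2)"
      using S by (auto simp: B_def)
    show "0 \<le> \<alpha> + S / 2" using S0 \<alpha> by simp
    fix x :: "'j \<Rightarrow> complex"
    define \<nu> where "\<nu> = (\<Sum>j\<in>T. (cmod (x j))\<^sup>2)"
    have \<nu>0: "0 \<le> \<nu>" unfolding \<nu>_def by (intro sum_nonneg) auto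
    have "\<bar>quad_defect m T a x\<bar> \<le> (\<alpha> + S / 2) * \<nu>"
    proof (cases "\<nu> = 0")
      case True then show ?thesis using Sb[of x] by (simp add: \<nu>_def)
    next
      case False
      then have \<nu>: "0 < \<nu>" using \<nu>0 by simp
      have k: "0 < k"
      proof -
        have "T \<noteq> {}" using False by (auto simp: \<nu>_def)
        then show ?thesis using T by (simp add: k_def card_gt_0_iff)
      qed
      define c where "c = sqrt (32 * k / \<nu>)"
      have c2: "c\<^sup>2 = 32 * k / \<nu>" using k \<nu> by (simp add: c_def)
      define y where "y j = of_real c * x j" for j
      have ny: "(\<Sum>j\<in>T. (cmod (y j))\<^sup>2) = 32 * k"
      proof -
        have "(\<Sum>j\<in>T. (cmod (y j))\<^sup>2) = c\<^sup>2 * \<nu>"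
          by (simp add: y_def norm_mult power_mult_distrib sum_distrib_left \<nu>_def)
        then show ?thesis using \<nu> c2 by simp
      qed
      then obtain f where f: "f \<in> lattice_net T (8 * card T)"
        and nf: "(\<Sum>j\<in>T. (cmod (gauss_int f j))\<^sup>2) \<le> 32 * k"
        and nd: "(\<Sum>j\<in>T. (cmod (y j - gauss_int f j))\<^sup>2) \<le> 2 * k"
        using lattice_net_approx[OF T, of y] by (auto simp: k_def)
      define z where "z = gauss_int f"
      \<comment> \<open>The value \<open>t\<^sup>2 = 8\<close> balances the two contributions. The
        squared norms of the polarized vectors add up to 2 * 8 * |y - z|^2 + 2 * |y + z|^2 / 8,
        where |y - z|^2 is at most 2k and |y + z|^2 at most 128k; each term is at most 32k. Division
        by 4 leaves 16k * \<open>S\<close>, half of \<open>S\<close> times the squared norm 32k of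
        \<open>y\<close>.\<close>
      define t where "t = sqrt (sqrt 64)"
      have t: "t \<noteq> 0" "t\<^sup>2 = 8" by (simp_all add: t_def real_sqrt_unique)
      let ?p = "\<lambda>j. t *\<^sub>R (y j - z j) + (y j + z j) /\<^sub>R t"
      let ?r = "\<lambda>j. t *\<^sub>R (y j - z j) - (y j + z j) /\<^sub>R t"
      have "(\<Sum>j\<in>T. (cmod (?p j))\<^sup>2) + (\<Sum>j\<in>T. (cmod (?r j))\<^sup>2)
        = (\<Sum>j\<in>T. 16 * (cmod (y j - z j))\<^sup>2 + (cmod (y j + z j))\<^sup>2 / 4)"
      proof -
        have "(cmod (t *\<^sub>R u + v /\<^sub>R t))\<^sup>2 + (cmod (t *\<^sub>R u - v /\<^sub>R t))\<^sup>2
          = 16 * (cmod u)\<^sup>2 + (cmod v)\<^sup>2 / 4" for u v :: complex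
        proof -
          have "(t * p + inverse t * q)\<^sup>2 + (t * p - inverse t * q)\<^sup>2 = 16 * p\<^sup>2 + q\<^sup>2 / 4" for p q
          proof -
            have "(t * p + inverse t * q)\<^sup>2 + (t * p - inverse t * q)\<^sup>2
              = 2 * (t\<^sup>2 * p\<^sup>2) + 2 * ((inverse t)\<^sup>2 * q\<^sup>2)"
              by (simp add: power2_eq_square algebra_simps)
            then show ?thesis using t by (simp add: power_inverse)
          qed
          from this[of "Re u" "Re v"] this[of "Im u" "Im v"] show ?thesis
            by (simp add: cmod_power2 add_divide_distrib)
        qed
        then show ?thesis by (simp add: sum.distrib[symmetric])
      qed
      also have "\<dots> \<le> (\<Sum>j\<in>T. 16 * (cmod (y j - z j))\<^sup>2 + ((cmod (y j))\<^sup>2 + (cmod (z j))\<^sup>2) / 2)"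
      proof (intro sum_mono add_left_mono)
        fix j
        have "(p + q)\<^sup>2 \<le> 2 * (p\<^sup>2 + q\<^sup>2)" for p q :: real
          using zero_le_power2[of "p - q"] by (simp add: power2_diff power2_sum)
        from this[of "Re (y j)" "Re (z j)"] this[of "Im (y j)" "Im (z j)"]
        show "(cmod (y j + z j))\<^sup>2 / 4 \<le> ((cmod (y j))\<^sup>2 + (cmod (z j))\<^sup>2) / 2"
          by (simp add: cmod_power2)
      qed
      also have "\<dots> = 16 * (\<Sum>j\<in>T. (cmod (y j - z j))\<^sup>2)
          + ((\<Sum>j\<in>T. (cmod (y j))\<^sup>2) + (\<Sum>j\<in>T. (cmod (z j))\<^sup>2)) / 2"
        by (simp add: sum.distrib sum_distrib_left sum_divide_distrib add_divide_distrib)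
      also have "\<dots> \<le> 64 * k"
        using ny nf nd unfolding z_def add_divide_distrib by linarith
      finally have par: "(\<Sum>j\<in>T. (cmod (?p j))\<^sup>2) + (\<Sum>j\<in>T. (cmod (?r j))\<^sup>2) \<le> 64 * k" .
      have "quad_defect m T a y - quad_defect m T a z = (quad_defect m T a ?p - quad_defect m T a ?r) / 4"
        by (rule quad_defect_polar[OF t(1)])
      then have "\<bar>quad_defect m T a y\<bar> \<le> \<bar>quad_defect m T a z\<bar>
          + (\<bar>quad_defect m T a ?p\<bar> + \<bar>quad_defect m T a ?r\<bar>) / 4"
        unfolding add_divide_distrib diff_divide_distrib by linarith
      also have "\<dots> \<le> \<alpha> * (32 * k) + S * (64 * k) / 4"
      proof (intro add_mono divide_right_mono)
        show "\<bar>quad_defect m T a z\<bar> \<le> \<alpha> * (32 * k)"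
          using net[OF f] mult_left_mono[OF nf \<alpha>] by (simp add: z_def)
        show "\<bar>quad_defect m T a ?p\<bar> + \<bar>quad_defect m T a ?r\<bar> \<le> S * (64 * k)"
          using Sb[of ?p] Sb[of ?r] mult_left_mono[OF par S0] by (simp add: distrib_left)
      qed simp
      also have "\<dots> = (\<alpha> + S / 2) * (32 * k)" by (simp add: algebra_simps)
      finally have "c\<^sup>2 * \<bar>quad_defect m T a x\<bar> \<le> (\<alpha> + S / 2) * (32 * k)"
        using quad_defect_scale[of m T a c x] unfolding y_def by (simp add: abs_mult)
      then have "(32 * k) * \<bar>quad_defect m T a x\<bar> \<le> (32 * k) * ((\<alpha> + S / 2) * \<nu>)"
        using \<nu> unfolding c2 by (simp add: pos_divide_le_eq mult_ac)
      then show ?thesis using k by simp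
    qed
    then show "\<bar>quad_defect m T a x\<bar> \<le> (\<alpha> + S / 2) * (\<Sum>j\<in>T. (cmod (x j))\<^sup>2)"
      by (simp add: \<nu>_def)
  qed
  obtain S where S: "B S" using quad_defect_bounded[OF T, of m a] by (auto simp: B_def)
  \<comment> \<open>This is the n-fold iterate of the affine map sending \<open>S\<close> to
    \<open>\<alpha> + S / 2\<close>, whose fixed point is \<open>2 * \<alpha>\<close>. Letting n
    grow with the vector fixed takes the place of an argument with the least bound.\<close>
  have it: "B (2 * \<alpha> + (1/2) ^ n * (S - 2 * \<alpha>))" for n
  proof (induction n)
    case (Suc n)
    show ?case using improve[OF Suc] by (simp add: field_simps)
  qed (use S in simp)
  have "(\<lambda>n. (2 * \<alpha> + (1/2) ^ n * (S - 2 * \<alpha>)) * (\<Sum>j\<in>T. (cmod (x j))\<^sup>2))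
      \<longlonglongrightarrow> (2 * \<alpha> + 0 * (S - 2 * \<alpha>)) * (\<Sum>j\<in>T. (cmod (x j))\<^sup>2)"
    by (intro tendsto_intros LIMSEQ_realpow_zero) auto
  then show ?thesis
    using it by (intro LIMSEQ_le_const[where X = "\<lambda>n. (2 * \<alpha> + (1/2) ^ n * (S - 2 * \<alpha>)) * (\<Sum>j\<in>T. (cmod (x j))\<^sup>2)"])
      (auto simp: B_def)
qed

subsection \<open>Chi-square concentration\<close>

text \<open>The left side is the logarithm of the moment generating function of Y^2 - 1 at \<theta>
  for a standard normal Y. The range of \<theta> keeps the argument -2 \<theta> within 1/2 of 0,
  where ln (1 + x) differs from x by at most 2 x^2.\<close>

lemma ln_one_minus_two_ge:
  fixes \<theta> :: real
  assumes "\<bar>\<theta>\<bar> \<le> 1 / 4"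
  shows "- \<theta> - ln (1 - 2 * \<theta>) / 2 \<le> 4 * \<theta>\<^sup>2"
proof -
  have "\<bar>ln (1 + - 2 * \<theta>) - - 2 * \<theta>\<bar> \<le> 2 * (- 2 * \<theta>)\<^sup>2"
    using assms by (intro abs_ln_one_plus_x_minus_x_bound) (simp add: abs_mult)
  then have "\<bar>ln (1 - 2 * \<theta>) + 2 * \<theta>\<bar> \<le> 8 * \<theta>\<^sup>2" by (simp add: power_mult_distrib)
  then show ?thesis by linarith
qed

text \<open>Exponential tilting by a square turns the standard normal density into a multiple of the
  centred normal density of variance 1 / (1 - 2 \<theta>); its total mass gives the integral
  exactly.\<close>

lemma (in prob_space) nn_integral_exp_normal_square:
  assumes Y: "distributed M lborel Y std_normal_density" and \<theta>: "\<bar>\<theta>\<bar> \<le> 1 / 4"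
  shows "(\<integral>\<^sup>+\<omega>. ennreal (exp (\<theta> * ((Y \<omega>)\<^sup>2 - 1))) \<partial>M) \<le> ennreal (exp (4 * \<theta>\<^sup>2))"
proof -
  define \<tau> where "\<tau> = 1 / sqrt (1 - 2 * \<theta>)"
  have p: "0 < 1 - 2 * \<theta>" using \<theta> by linarith
  have \<tau>: "0 < \<tau>" "\<tau>\<^sup>2 = 1 / (1 - 2 * \<theta>)" using p by (simp_all add: \<tau>_def power_divide)
  have e\<tau>: "exp (- \<theta>) * \<tau> = exp (- \<theta> - ln (1 - 2 * \<theta>) / 2)"
    using p by (simp add: \<tau>_def exp_diff ln_sqrt[symmetric])
  have dens: "std_normal_density x * exp (\<theta> * (x\<^sup>2 - 1)) = exp (- \<theta>) * \<tau> * normal_density 0 \<tau> x" for x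
  proof -
    have "sqrt (2 * pi * \<tau>\<^sup>2) = sqrt (2 * pi) * \<tau>" using \<tau>(1) by (simp add: real_sqrt_mult)
    then have "exp (- \<theta>) * \<tau> * normal_density 0 \<tau> x
        = exp (- \<theta>) * exp (- (x\<^sup>2 * (1 - 2 * \<theta>)) / 2) / sqrt (2 * pi)"
      using \<tau> by (simp add: normal_density_def)
    also have "exp (- \<theta>) * exp (- (x\<^sup>2 * (1 - 2 * \<theta>)) / 2) = exp (- x\<^sup>2 / 2) * exp (\<theta> * (x\<^sup>2 - 1))"
      unfolding exp_add[symmetric] by (simp add: field_simps)
    finally show ?thesis by (simp add: std_normal_density_def)
  qed
  have "(\<integral>\<^sup>+\<omega>. ennreal (exp (\<theta> * ((Y \<omega>)\<^sup>2 - 1))) \<partial>M)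
      = (\<integral>\<^sup>+x. ennreal (std_normal_density x) * ennreal (exp (\<theta> * (x\<^sup>2 - 1))) \<partial>lborel)"
    by (rule distributed_nn_integral[OF Y, symmetric]) simp
  also have "\<dots> = (\<integral>\<^sup>+x. ennreal (exp (- \<theta>) * \<tau>) * ennreal (normal_density 0 \<tau> x) \<partial>lborel)"
    using \<tau>(1) by (simp add: ennreal_mult'[symmetric] dens)
  also have "\<dots> = ennreal (exp (- \<theta>) * \<tau>)"
    using \<tau>(1) by (simp add: nn_integral_cmult nn_integral_eq_integral)
  also have "\<dots> \<le> ennreal (exp (4 * \<theta>\<^sup>2))"
    unfolding e\<tau> using ln_one_minus_two_ge[OF \<theta>] by (intro ennreal_leI) simp
  finally show ?thesis .
qed

text \<open>Chernoff's bound, with the sign \<open>s\<close> covering the upper and the lower tail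
  by one computation.\<close>

lemma (in prob_space) chi_square_one_sided:
  fixes Y :: "'i \<Rightarrow> 'a \<Rightarrow> real" and s t :: real
  assumes I: "finite I" "indep_vars (\<lambda>_. borel) Y I"
    and Y: "\<And>i. i \<in> I \<Longrightarrow> distributed M lborel (Y i) std_normal_density"
    and t: "0 < t" "t \<le> 2" and s: "\<bar>s\<bar> = 1"
  shows "prob {\<omega>\<in>space M. t * card I \<le> s * ((\<Sum>i\<in>I. (Y i \<omega>)\<^sup>2) - card I)} \<le> exp (- (t\<^sup>2 * card I / 16))"
proof -
  \<comment> \<open>The minimum of - t |\<theta>| + 4 \<theta>^2 is attained at |\<theta>| = t / 8
    and equals - t^2 / 16. The assumption t <= 2 gives |\<theta>| <= 1/4. Below, \<open>c\<close> is
    the Markov factor exp (- |\<theta>| t \<open>card I\<close>).\<close>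
  define \<theta> where "\<theta> = s * t / 8"
  have ss: "s * s = 1" using s by (metis abs_mult_self_eq mult_1)
  have \<theta>: "\<bar>\<theta>\<bar> \<le> 1 / 4" "\<theta>\<^sup>2 = t\<^sup>2 / 64"
    using t s ss by (simp_all add: \<theta>_def abs_mult power2_eq_square)
  define u where "u \<omega> = (\<Prod>i\<in>I. exp (\<theta> * ((Y i \<omega>)\<^sup>2 - 1)))" for \<omega>
  have u: "u \<omega> = exp (\<theta> * ((\<Sum>i\<in>I. (Y i \<omega>)\<^sup>2) - card I))" for \<omega>
    using I(1) by (simp add: u_def exp_sum[symmetric] sum_distrib_left[symmetric] sum_subtractf)
  have rv [measurable]: "Y i \<in> borel_measurable M" if "i \<in> I" for i
    using I(2) that by (auto simp: indep_vars_def)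
  have [measurable]: "u \<in> borel_measurable M" unfolding u_def by measurable
  define c where "c = exp (- (t\<^sup>2 * card I / 8))"
  have iff: "t * card I \<le> s * ((\<Sum>i\<in>I. (Y i \<omega>)\<^sup>2) - card I) \<longleftrightarrow> 1 \<le> ennreal c * ennreal (u \<omega>)" for \<omega>
  proof -
    have "1 \<le> ennreal c * ennreal (u \<omega>) \<longleftrightarrow> 1 \<le> c * u \<omega>"
      by (simp add: c_def u ennreal_mult'[symmetric] ennreal_1[symmetric] del: ennreal_1)
    also have "\<dots> \<longleftrightarrow> 0 \<le> - (t\<^sup>2 * card I / 8) + \<theta> * ((\<Sum>i\<in>I. (Y i \<omega>)\<^sup>2) - card I)"
      unfolding c_def u exp_add[symmetric] by simp
    also have "\<dots> \<longleftrightarrow> 0 \<le> t / 8 * (s * ((\<Sum>i\<in>I. (Y i \<omega>)\<^sup>2) - card I) - t * card I)"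
      by (simp add: \<theta>_def power2_eq_square algebra_simps)
    finally show ?thesis using t by (auto simp: zero_le_mult_iff)
  qed
  have "emeasure M {\<omega>\<in>space M. t * card I \<le> s * ((\<Sum>i\<in>I. (Y i \<omega>)\<^sup>2) - card I)}
     \<le> ennreal (exp (- (t\<^sup>2 * card I / 16)))"
  proof -
    have "emeasure M {\<omega>\<in>space M. t * card I \<le> s * ((\<Sum>i\<in>I. (Y i \<omega>)\<^sup>2) - card I)}
      = emeasure M {\<omega>\<in>space M. 1 \<le> ennreal c * ennreal (u \<omega>)}"
      using iff by simp
    also have "\<dots> \<le> ennreal c * (\<integral>\<^sup>+\<omega>. ennreal (u \<omega>) * indicator (space M) \<omega> \<partial>M)"
      by (rule nn_integral_Markov_inequality) auto
    also have "(\<integral>\<^sup>+\<omega>. ennreal (u \<omega>) * indicator (space M) \<omega> \<partial>M)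
        = (\<integral>\<^sup>+\<omega>. (\<Prod>i\<in>I. ennreal (exp (\<theta> * ((Y i \<omega>)\<^sup>2 - 1)))) \<partial>M)"
      by (intro nn_integral_cong) (simp add: u_def prod_ennreal)
    also have "\<dots> = (\<Prod>i\<in>I. \<integral>\<^sup>+\<omega>. ennreal (exp (\<theta> * ((Y i \<omega>)\<^sup>2 - 1))) \<partial>M)"
      by (intro indep_vars_nn_integral I indep_vars_compose2[OF I(2)]) auto
    also have "ennreal c * \<dots> \<le> ennreal c * (\<Prod>i\<in>I. ennreal (exp (4 * \<theta>\<^sup>2)))"
      by (intro mult_left_mono prod_mono_ennreal nn_integral_exp_normal_square Y \<theta>) auto
    also have "\<dots> = ennreal (exp (- (t\<^sup>2 * card I / 16)))"
      by (simp add: c_def \<theta> prod_ennreal ennreal_power ennreal_mult'[symmetric] exp_of_nat_mult[symmetric]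
          exp_add[symmetric] field_simps)
    finally show ?thesis .
  qed
  then show ?thesis by (simp add: emeasure_eq_measure)
qed

lemma (in prob_space) chi_square_tail:
  fixes Y :: "'i \<Rightarrow> 'a \<Rightarrow> real" and t :: real
  assumes I: "finite I" "indep_vars (\<lambda>_. borel) Y I"
    and Y: "\<And>i. i \<in> I \<Longrightarrow> distributed M lborel (Y i) std_normal_density"
    and t: "0 < t" "t \<le> 2"
  shows "prob {\<omega>\<in>space M. t * card I < \<bar>(\<Sum>i\<in>I. (Y i \<omega>)\<^sup>2) - card I\<bar>} \<le> 2 * exp (- (t\<^sup>2 * card I / 16))"
proof -
  let ?B = "\<lambda>s::real. {\<omega>\<in>space M. t * card I \<le> s * ((\<Sum>i\<in>I. (Y i \<omega>)\<^sup>2) - card I)}"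
  have rv [measurable]: "Y i \<in> borel_measurable M" if "i \<in> I" for i
    using I(2) that by (auto simp: indep_vars_def)
  have ev: "?B s \<in> events" for s :: real by measurable
  have "prob {\<omega>\<in>space M. t * card I < \<bar>(\<Sum>i\<in>I. (Y i \<omega>)\<^sup>2) - card I\<bar>} \<le> prob (?B 1 \<union> ?B (- 1))"
    by (intro finite_measure_mono sets.Un ev) (auto simp: abs_real_def split: if_splits)
  also have "\<dots> \<le> prob (?B 1) + prob (?B (- 1))"
    by (intro measure_Un_le ev)
  also have "\<dots> \<le> 2 * exp (- (t\<^sup>2 * card I / 16))"
    using chi_square_one_sided[OF I Y t, of 1] chi_square_one_sided[OF I Y t, of "- 1"] by simp
  finally show ?thesis .
qed

section \<open>Gaussian functionals of independent entries\<close>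

text \<open>On the product space the joint coordinate map is the identity, so its law is the product
  of the marginals. This criterion for independence is applied for nonempty \<open>I\<close>; the
  empty family is settled directly.\<close>

lemma indep_vars_PiM_coordinates:
  assumes \<mu>: "\<And>i. i \<in> I \<Longrightarrow> prob_space (\<mu> i)"
  shows "prob_space.indep_vars (PiM I \<mu>) \<mu> (\<lambda>i \<omega>. \<omega> i) I"
proof (cases "I = {}")
  case True
  interpret prob_space "PiM I \<mu>" by (rule prob_space_PiM) (rule \<mu>)
  show ?thesis unfolding indep_vars_def indep_sets_def using True by simp
next
  case False
  interpret prob_space "PiM I \<mu>" by (rule prob_space_PiM) (rule \<mu>)
  have "distr (PiM I \<mu>) (PiM I \<mu>) (\<lambda>\<omega>. \<lambda>i\<in>I. \<omega> i) = distr (PiM I \<mu>) (PiM I \<mu>) (\<lambda>\<omega>. \<omega>)"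
    by (rule distr_cong) (auto simp: space_PiM)
  also have "\<dots> = PiM I (\<lambda>i. distr (PiM I \<mu>) (\<mu> i) (\<lambda>\<omega>. \<omega> i))"
    by (simp add: distr_PiM_component \<mu> cong: PiM_cong)
  finally show ?thesis
    using False by (subst indep_vars_iff_distr_eq_PiM') (auto intro: measurable_component_singleton)
qed

text \<open>The law N(0, r^2) including the degenerate case, in which there is no density. That case
  does occur: a real entry multiplied by an imaginary coefficient has real part 0.\<close>

definition gaussian_functional :: "'a measure \<Rightarrow> ('a \<Rightarrow> real) \<Rightarrow> real \<Rightarrow> bool" where
  "gaussian_functional \<mu> f r \<longleftrightarrow> f \<in> borel_measurable \<mu> \<and> 0 \<le> r \<and>
     (if r = 0 then AE a in \<mu>. f a = 0 else distributed \<mu> lborel f (normal_density 0 r))"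

lemma distributed_PiM_component:
  assumes \<mu>: "\<And>i. i \<in> I \<Longrightarrow> prob_space (\<mu> i)" and i: "i \<in> I"
    and f: "distributed (\<mu> i) N f D"
  shows "distributed (PiM I \<mu>) N (\<lambda>\<omega>. f (\<omega> i)) D"
proof -
  have [measurable]: "f \<in> \<mu> i \<rightarrow>\<^sub>M N" using f by (simp add: distributed_def)
  have "distr (PiM I \<mu>) N (\<lambda>\<omega>. f (\<omega> i)) = distr (distr (PiM I \<mu>) (\<mu> i) (\<lambda>\<omega>. \<omega> i)) N f"
    using i by (subst distr_distr) (auto simp: comp_def)
  then show ?thesis
    using f i by (simp add: distributed_def distr_PiM_component \<mu>)
qed

text \<open>Different rows involve disjoint sets of entries, so the m row sums are independent, and
  each is centred normal with variance the sum of the squares of \<open>r\<close>. Division by the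
  standard deviation reduces the claim to the chi-square tail.\<close>

lemma row_sums_tail:
  fixes f :: "'j \<Rightarrow> 'a \<Rightarrow> real" and r :: "'j \<Rightarrow> real"
  defines "M \<equiv> \<lambda>\<mu> m D. PiM ({..<m::nat} \<times> D) (\<lambda>_. \<mu>)"
  assumes \<mu>: "prob_space \<mu>" and D: "finite D" "T \<subseteq> D"
    and f: "\<And>j. j \<in> T \<Longrightarrow> gaussian_functional \<mu> (f j) (r j)"
    and t: "0 < t" "t \<le> 2"
  shows "measure (M \<mu> m D) {A \<in> space (M \<mu> m D).
      t * (real m * (\<Sum>j\<in>T. (r j)\<^sup>2)) <
      \<bar>(\<Sum>i<m. (\<Sum>j\<in>T. f j (A (i, j)))\<^sup>2) - real m * (\<Sum>j\<in>T. (r j)\<^sup>2)\<bar>} \<le> 2 * exp (- (t\<^sup>2 * m / 16))"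
proof -
  let ?I = "{..<m} \<times> D"
  define P where "P = M \<mu> m D"
  have P: "P = PiM ?I (\<lambda>_. \<mu>)" by (simp add: P_def M_def)
  interpret P: prob_space P unfolding P by (rule prob_space_PiM) (rule \<mu>)
  define R where "R = (\<Sum>j\<in>T. (r j)\<^sup>2)"
  \<comment> \<open>Sums of independent normals are formed from positive standard deviations only.
    The degenerate columns vanish almost everywhere and are split off first.\<close>
  define T' where "T' = {j\<in>T. r j \<noteq> 0}"
  have T: "finite T" using D by (rule rev_finite_subset)
  then have T': "finite T'" "T' \<subseteq> T" by (auto simp: T'_def)
  have R': "R = (\<Sum>j\<in>T'. (r j)\<^sup>2)"
    unfolding R_def using T T' by (intro sum.mono_neutral_right) (auto simp: T'_def)
  have fm: "f j \<in> borel_measurable \<mu>" if "j \<in> T" for j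
    using f[OF that] by (simp add: gaussian_functional_def)
  have cm: "(\<lambda>A. A p) \<in> P \<rightarrow>\<^sub>M \<mu>" if "p \<in> ?I" for p
    unfolding P using that by measurable
  have fcm [measurable]: "(\<lambda>A. f j (A (i, j))) \<in> borel_measurable P" if "i \<in> {..<m}" "j \<in> T" for i j
    using that D by (intro measurable_compose[OF cm fm]) auto
  have AE0: "AE A in P. \<forall>i\<in>{..<m}. \<forall>j\<in>T - T'. f j (A (i, j)) = 0"
  proof (intro AE_finite_allI)
    fix i j assume i: "i \<in> {..<m}" and j: "j \<in> T - T'"
    have "AE a in \<mu>. f j a = 0" using f[of j] j by (auto simp: gaussian_functional_def T'_def)
    then show "AE A in P. f j (A (i, j)) = 0"
      unfolding P using i j D by (intro AE_PiM_component \<mu>) auto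
  qed (use T in auto)
  define Z where "Z i A = (\<Sum>j\<in>T'. f j (A (i, j)))" for i and A :: "nat \<times> 'j \<Rightarrow> 'a"
  have AEZ: "AE A in P. \<forall>i\<in>{..<m}. (\<Sum>j\<in>T. f j (A (i, j))) = Z i A"
    using AE0
  proof eventually_elim
    case (elim A)
    then show ?case unfolding Z_def using T T' by (intro ballI sum.mono_neutral_right) auto
  qed
  define B where "B A \<longleftrightarrow> t * (real m * R) < \<bar>(\<Sum>i<m. (\<Sum>j\<in>T. f j (A (i, j)))\<^sup>2) - real m * R\<bar>" for A
  have "P.prob {A \<in> space P. B A} \<le> 2 * exp (- (t\<^sup>2 * m / 16))"
  proof (cases "T' = {}")
    \<comment> \<open>All row sums vanish almost everywhere and \<open>R\<close> is 0. The strict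
      inequality in the event then reads 0 < 0, so the event is null.\<close>
    case True
    have "P.prob {A \<in> space P. B A} = P.prob {}"
    proof (rule P.finite_measure_eq_AE)
      show "AE A in P. (A \<in> {A \<in> space P. B A}) = (A \<in> {})"
        using AEZ by eventually_elim (use True R' in \<open>simp add: B_def Z_def\<close>)
      show "{A \<in> space P. B A} \<in> P.events"
        unfolding B_def by measurable
    qed simp
    then show ?thesis by simp
  next
    case False
    have R: "0 < R" unfolding R' using False T' by (intro sum_pos) (auto simp: T'_def)
    define Y where "Y i A = Z i A / sqrt R" for i A
    have coord: "P.indep_vars (\<lambda>_. \<mu>) (\<lambda>p A. A p) ?I"
      unfolding P by (rule indep_vars_PiM_coordinates) (rule \<mu>)
    \<comment> \<open>Grouping the independent entries by rows; \<open>Y i\<close> is a function of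
      the i-th group alone.\<close>
    have "P.indep_vars (\<lambda>i. PiM ({i} \<times> D) (\<lambda>_. \<mu>)) (\<lambda>i A. restrict (\<lambda>p. A p) ({i} \<times> D)) {..<m}"
      by (rule P.indep_vars_restrict[OF coord]) (auto simp: disjoint_family_on_def)
    then have "P.indep_vars (\<lambda>_. borel) (\<lambda>i A. Y i (restrict (\<lambda>p. A p) ({i} \<times> D))) {..<m}"
    proof (rule P.indep_vars_compose2)
      fix i assume "i \<in> {..<m}"
      have "(\<lambda>A. f j (A (i, j))) \<in> borel_measurable (PiM ({i} \<times> D) (\<lambda>_. \<mu>))" if "j \<in> T'" for j
        using that D T' by (intro measurable_compose[OF _ fm[of j]] measurable_component_singleton) auto
      then show "Y i \<in> borel_measurable (PiM ({i} \<times> D) (\<lambda>_. \<mu>))"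
        unfolding Y_def Z_def by measurable
    qed
    also have "(\<lambda>i A. Y i (restrict (\<lambda>p. A p) ({i} \<times> D))) = Y"
      using D T' by (intro ext) (auto simp: Y_def Z_def intro!: arg_cong2[where f="(/)"] sum.cong)
    finally have indY: "P.indep_vars (\<lambda>_. borel) Y {..<m}" .
    have dY: "distributed P lborel (Y i) std_normal_density" if i: "i \<in> {..<m}" for i
    proof -
      have sub: "{i} \<times> T' \<subseteq> ?I" using i D T' by auto
      have "distributed P lborel (\<lambda>A. \<Sum>p\<in>{i} \<times> T'. f (snd p) (A p))
          (normal_density (\<Sum>p\<in>{i} \<times> T'. 0) (sqrt (\<Sum>p\<in>{i} \<times> T'. (r (snd p))\<^sup>2)))"
      proof (rule P.sum_indep_normal)
        show "P.indep_vars (\<lambda>p. borel) (\<lambda>p A. f (snd p) (A p)) ({i} \<times> T')"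
          using T' fm by (intro P.indep_vars_compose2[OF P.indep_vars_subset[OF coord sub]]) auto
        fix p assume p: "p \<in> {i} \<times> T'"
        then have g: "gaussian_functional \<mu> (f (snd p)) (r (snd p))" "r (snd p) \<noteq> 0"
          using T' f by (auto simp: T'_def)
        then show "0 < r (snd p)" by (simp add: gaussian_functional_def)
        show "distributed P lborel (\<lambda>A. f (snd p) (A p)) (normal_density 0 (r (snd p)))"
          unfolding P using g p sub
          by (intro distributed_PiM_component \<mu>) (auto simp: gaussian_functional_def)
      qed (use False T' in auto)
      moreover have "(\<lambda>A. \<Sum>p\<in>{i} \<times> T'. f (snd p) (A p)) = Z i"
        by (simp add: Z_def sum.cartesian_product' fun_eq_iff)
      moreover have "(\<Sum>p\<in>{i} \<times> T'. (r (snd p))\<^sup>2) = R"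
        by (simp add: R' sum.cartesian_product')
      ultimately have "distributed P lborel (Z i) (normal_density 0 (sqrt R))" by simp
      then show ?thesis
        using P.normal_standard_normal_convert[of "sqrt R" "Z i" 0] R by (simp add: Y_def[abs_def])
    qed
    have Ym [measurable]: "Y i \<in> borel_measurable P" if "i \<in> {..<m}" for i
      using dY[OF that] by (simp add: distributed_def)
    have "P.prob {A \<in> space P. B A} \<le> P.prob {A \<in> space P. t * card {..<m} < \<bar>(\<Sum>i<m. (Y i A)\<^sup>2) - card {..<m}\<bar>}"
    proof (rule P.finite_measure_mono_AE)
      show "AE A in P. A \<in> {A \<in> space P. B A} \<longrightarrow>
          A \<in> {A \<in> space P. t * card {..<m} < \<bar>(\<Sum>i<m. (Y i A)\<^sup>2) - card {..<m}\<bar>}"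
        using AEZ
      proof eventually_elim
        case (elim A)
        have "(\<Sum>i<m. (\<Sum>j\<in>T. f j (A (i, j)))\<^sup>2) = R * (\<Sum>i<m. (Y i A)\<^sup>2)"
          using elim R by (simp add: Y_def power_divide sum_divide_distrib[symmetric])
        then have "(\<Sum>i<m. (\<Sum>j\<in>T. f j (A (i, j)))\<^sup>2) - real m * R = R * ((\<Sum>i<m. (Y i A)\<^sup>2) - m)"
          by (simp add: algebra_simps)
        then have "B A \<longleftrightarrow> R * (t * m) < R * \<bar>(\<Sum>i<m. (Y i A)\<^sup>2) - m\<bar>"
          using R by (simp add: B_def abs_mult mult_ac)
        then show ?case using R by simp
      qed
    qed measurable
    also have "\<dots> \<le> 2 * exp (- (t\<^sup>2 * card {..<m} / 16))"
      by (intro P.chi_square_tail indY dY t) auto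
    finally show ?thesis by simp
  qed
  then show ?thesis unfolding B_def R_def P_def .
qed

text \<open>Because Im z = Re (-\<i> z), the two values of \<open>r\<close> are the standard
  deviations of the real and the imaginary part of \<open>e a * c\<close>. Requiring only the sum of
  their squares to be |c|^2 admits real entries, with r c = |Re c|, as well as circular ones, with r
  c = |c| / sqrt 2. The map \<open>e\<close> lets a law on another sample space act as a complex
  entry.\<close>

definition gaussian_entry :: "'a measure \<Rightarrow> ('a \<Rightarrow> complex) \<Rightarrow> bool" where
  "gaussian_entry \<mu> e \<longleftrightarrow> prob_space \<mu> \<and> e \<in> borel_measurable \<mu> \<and>
     (\<exists>r. \<forall>c. gaussian_functional \<mu> (\<lambda>a. Re (e a * c)) (r c) \<and>
       (r c)\<^sup>2 + (r (- \<i> * c))\<^sup>2 = (cmod c)\<^sup>2)"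

lemma quad_defect_measurable:
  assumes e: "e \<in> borel_measurable \<mu>" and D: "T \<subseteq> D"
  shows "(\<lambda>A. quad_defect m T (\<lambda>i j. e (A (i, j))) x) \<in> borel_measurable (PiM ({..<m} \<times> D) (\<lambda>_. \<mu>))"
proof -
  have [measurable]: "(\<lambda>A. e (A (i, j))) \<in> borel_measurable (PiM ({..<m} \<times> D) (\<lambda>_. \<mu>))"
    if "i \<in> {..<m}" "j \<in> T" for i j
    using that D by (intro measurable_compose[OF _ e] measurable_component_singleton) auto
  show ?thesis unfolding quad_defect_def by measurable
qed

text \<open>Real and imaginary parts are each compared with their own mean, \<open>R 1\<close> and
  \<open>R (- \<i>)\<close>, with tolerance proportional to that mean. The means add up to m |x|^2,
  so the tolerances add up to the required one, and a union bound doubles the factor 2.\<close>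

lemma quad_defect_tail:
  fixes \<mu> :: "'a measure" and D :: "'j set"
  defines "M \<equiv> \<lambda>m. PiM ({..<m::nat} \<times> D) (\<lambda>_. \<mu>)"
  assumes e: "gaussian_entry \<mu> e" and D: "finite D" "T \<subseteq> D" and t: "0 < t" "t \<le> 2"
  shows "measure (M m) {A \<in> space (M m). t * (real m * (\<Sum>j\<in>T. (cmod (x j))\<^sup>2)) <
      \<bar>quad_defect m T (\<lambda>i j. e (A (i, j))) x\<bar>} \<le> 4 * exp (- (t\<^sup>2 * m / 16))"
proof -
  define P where "P = M m"
  have \<mu>: "prob_space \<mu>" and em: "e \<in> borel_measurable \<mu>" using e by (auto simp: gaussian_entry_def)
  obtain r where r: "\<And>c. gaussian_functional \<mu> (\<lambda>a. Re (e a * c)) (r c)"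
    and r2: "\<And>c. (r c)\<^sup>2 + (r (- \<i> * c))\<^sup>2 = (cmod c)\<^sup>2"
    using e by (auto simp: gaussian_entry_def)
  interpret P: prob_space P unfolding P_def M_def by (rule prob_space_PiM) (rule \<mu>)
  have [measurable]: "(\<lambda>A. e (A (i, j))) \<in> borel_measurable P"
    if "i \<in> {..<m}" "j \<in> T" for i j
    unfolding P_def M_def using that D
    by (intro measurable_compose[OF _ em] measurable_component_singleton) auto
  define X where "X c A = (\<Sum>i<m. (\<Sum>j\<in>T. Re (e (A (i, j)) * (c * x j)))\<^sup>2)" for c A
  define R where "R c = real m * (\<Sum>j\<in>T. (r (c * x j))\<^sup>2)" for c
  let ?B = "\<lambda>c. {A \<in> space P. t * R c < \<bar>X c A - R c\<bar>}"
  have tail: "P.prob (?B c) \<le> 2 * exp (- (t\<^sup>2 * m / 16))" for c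
    unfolding P_def M_def X_def R_def by (rule row_sums_tail[OF \<mu> D r t])
  have ev: "?B c \<in> P.events" for c unfolding X_def by measurable
  have X: "(\<Sum>i<m. (cmod (\<Sum>j\<in>T. e (A (i, j)) * x j))\<^sup>2) = X 1 A + X (- \<i>) A" for A
    unfolding X_def sum.distrib[symmetric]
  proof (intro sum.cong refl)
    fix i
    have "Im (\<Sum>j\<in>T. e (A (i, j)) * x j) = (\<Sum>j\<in>T. Re (e (A (i, j)) * (- \<i> * x j)))"
      by (simp add: algebra_simps)
    moreover have "Re (\<Sum>j\<in>T. e (A (i, j)) * x j) = (\<Sum>j\<in>T. Re (e (A (i, j)) * (1 * x j)))"
      by simp
    ultimately show "(cmod (\<Sum>j\<in>T. e (A (i, j)) * x j))\<^sup>2 = (\<Sum>j\<in>T. Re (e (A (i, j)) * (1 * x j)))\<^sup>2 +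
        (\<Sum>j\<in>T. Re (e (A (i, j)) * (- \<i> * x j)))\<^sup>2"
      unfolding cmod_power2 by (simp only:)
  qed
  have R: "real m * (\<Sum>j\<in>T. (cmod (x j))\<^sup>2) = R 1 + R (- \<i>)"
    unfolding R_def distrib_left[symmetric] sum.distrib[symmetric] by (simp add: r2[symmetric])
  have "P.prob {A \<in> space P. t * (real m * (\<Sum>j\<in>T. (cmod (x j))\<^sup>2)) <
      \<bar>quad_defect m T (\<lambda>i j. e (A (i, j))) x\<bar>} \<le> P.prob (?B 1 \<union> ?B (- \<i>))"
    unfolding quad_defect_def X R
    by (intro P.finite_measure_mono sets.Un ev) (auto simp: distrib_left)
  also have "\<dots> \<le> P.prob (?B 1) + P.prob (?B (- \<i>))"
    by (intro measure_Un_le ev)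
  also have "\<dots> \<le> 4 * exp (- (t\<^sup>2 * m / 16))"
    using tail[of 1] tail[of "- \<i>"] by simp
  finally show ?thesis unfolding P_def .
qed

section \<open>The entry laws: real, real embedded in the complex numbers, and circular
  complex\<close>

lemma prob_space_std_normal: "prob_space std_normal"
  unfolding std_normal_def by (rule prob_space_normal_density) simp

lemma distributed_std_normal_id: "distributed std_normal lborel (\<lambda>x. x) std_normal_density"
proof -
  have "distr std_normal lborel (\<lambda>x. x) = std_normal"
    by (rule distr_id2) (simp add: std_normal_def)
  then show ?thesis by (simp add: distributed_def std_normal_def)
qed

lemma gaussian_functional_scale:
  assumes \<mu>: "prob_space \<mu>" and f: "distributed \<mu> lborel f std_normal_density"
  shows "gaussian_functional \<mu> (\<lambda>a. f a * c) \<bar>c\<bar>"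
proof -
  interpret prob_space \<mu> by (rule \<mu>)
  have [measurable]: "f \<in> borel_measurable \<mu>" using f by (simp add: distributed_def)
  have "distributed \<mu> lborel (\<lambda>a. 0 + c * f a) (normal_density (0 + c * 0) (\<bar>c\<bar> * 1))" if "c \<noteq> 0"
    using that f by (intro normal_density_affine) auto
  then show ?thesis by (simp add: gaussian_functional_def mult.commute)
qed

lemma gaussian_entry_of_real: "gaussian_entry std_normal complex_of_real"
  unfolding gaussian_entry_def
proof (intro conjI exI allI prob_space_std_normal)
  show "complex_of_real \<in> borel_measurable std_normal" by (simp add: std_normal_def)
  fix c
  show "gaussian_functional std_normal (\<lambda>a. Re (complex_of_real a * c)) \<bar>Re c\<bar>"
    using gaussian_functional_scale[OF prob_space_std_normal distributed_std_normal_id] by simp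
  show "\<bar>Re c\<bar>\<^sup>2 + \<bar>Re (- \<i> * c)\<bar>\<^sup>2 = (cmod c)\<^sup>2" by (simp add: cmod_power2)
qed

text \<open>Being a Gaussian entry depends only on the law of \<open>e\<close>. Both complex laws
  are image measures of real Gaussians, so they inherit the property from the underlying real sample
  space.\<close>

lemma gaussian_entry_distr:
  assumes e: "gaussian_entry \<mu> e"
  shows "gaussian_entry (distr \<mu> borel e) (\<lambda>z. z)"
proof -
  have em [measurable]: "e \<in> borel_measurable \<mu>" using e by (simp add: gaussian_entry_def)
  have "gaussian_functional (distr \<mu> borel e) (\<lambda>z. Re (z * c)) r"
    if r: "gaussian_functional \<mu> (\<lambda>a. Re (e a * c)) r" for c r
  proof -
    have "distr (distr \<mu> borel e) lborel (\<lambda>z. Re (z * c)) = distr \<mu> lborel (\<lambda>a. Re (e a * c))"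
      by (subst distr_distr) (auto simp: comp_def)
    then show ?thesis
      using r by (auto simp: gaussian_functional_def distributed_def AE_distr_iff split: if_splits)
  qed
  then show ?thesis
    using e by (fastforce simp: gaussian_entry_def intro!: prob_space.prob_space_distr)
qed

lemma distr_pair_snd:
  assumes "prob_space M" "prob_space N"
  shows "distr (M \<Otimes>\<^sub>M N) N snd = N"
proof -
  interpret M: prob_space M by fact
  interpret N: prob_space N by fact
  interpret pair_sigma_finite M N ..
  have "distr (M \<Otimes>\<^sub>M N) N snd = distr (N \<Otimes>\<^sub>M M) N (snd \<circ> (\<lambda>(x, y). (y, x)))"
    by (subst distr_pair_swap) (simp add: distr_distr)
  also have "snd \<circ> (\<lambda>(x, y). (y, x)) = fst" by auto
  finally show ?thesis by (simp add: M.distr_pair_fst)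
qed

lemma distributed_pair_std_normal:
  "distributed (std_normal \<Otimes>\<^sub>M std_normal) lborel fst std_normal_density"
  "distributed (std_normal \<Otimes>\<^sub>M std_normal) lborel snd std_normal_density"
proof -
  interpret prob_space std_normal by (rule prob_space_std_normal)
  have s: "sets std_normal = sets lborel" by (simp add: std_normal_def)
  have "distr (std_normal \<Otimes>\<^sub>M std_normal) lborel fst = std_normal"
    using distr_pair_fst[of std_normal] by (simp add: distr_cong[OF refl s refl])
  moreover have "distr (std_normal \<Otimes>\<^sub>M std_normal) lborel snd = std_normal"
    using distr_pair_snd[OF prob_space_std_normal prob_space_std_normal]
    by (simp add: distr_cong[OF refl s refl])
  moreover have "fst \<in> std_normal \<Otimes>\<^sub>M std_normal \<rightarrow>\<^sub>M lborel" "snd \<in> std_normal \<Otimes>\<^sub>M std_normal \<rightarrow>\<^sub>M lborel"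
    using measurable_fst[of std_normal std_normal] measurable_snd[of std_normal std_normal]
    by (simp_all add: measurable_cong_sets[OF refl s])
  ultimately show "distributed (std_normal \<Otimes>\<^sub>M std_normal) lborel fst std_normal_density"
    "distributed (std_normal \<Otimes>\<^sub>M std_normal) lborel snd std_normal_density"
    by (simp_all add: distributed_def std_normal_def)
qed

lemma gaussian_functional_pair:
  "gaussian_functional (std_normal \<Otimes>\<^sub>M std_normal) (\<lambda>p. fst p * a + snd p * b) (sqrt (a\<^sup>2 + b\<^sup>2))"
proof -
  let ?P = "std_normal \<Otimes>\<^sub>M std_normal"
  interpret S: prob_space std_normal by (rule prob_space_std_normal)
  interpret pair_prob_space std_normal std_normal ..
  note d = distributed_pair_std_normal
  have m [measurable]: "fst \<in> borel_measurable ?P" "snd \<in> borel_measurable ?P"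
    using d by (simp_all add: distributed_def)
  have g: "gaussian_functional ?P (\<lambda>p. fst p * a) \<bar>a\<bar>" "gaussian_functional ?P (\<lambda>p. snd p * b) \<bar>b\<bar>"
    using d by (auto intro!: gaussian_functional_scale prob_space_axioms)
  have s: "sets std_normal = sets (borel :: real measure)" by (simp add: std_normal_def)
  show ?thesis
  proof (cases "a = 0 \<or> b = 0")
    \<comment> \<open>The addition theorem for independent normals needs two positive standard
      deviations. Here one summand vanishes, and a single scaled coordinate remains.\<close>
    case True
    then show ?thesis using g by auto
  next
    case False
    have "indep_var borel fst borel snd"
      unfolding indep_var_distribution_eq
    proof (intro conjI m)
      have "distr ?P borel fst \<Otimes>\<^sub>M distr ?P borel snd = ?P"
        using S.distr_pair_fst[of std_normal] distr_pair_snd[OF prob_space_std_normal prob_space_std_normal]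
        by (simp add: distr_cong[OF refl s refl])
      also have "\<dots> = distr ?P (borel \<Otimes>\<^sub>M borel) (\<lambda>x. (fst x, snd x))"
        by (simp add: distr_id2 sets_pair_measure_cong[OF s s])
      finally show "distr ?P borel fst \<Otimes>\<^sub>M distr ?P borel snd
        = distr ?P (borel \<Otimes>\<^sub>M borel) (\<lambda>x. (fst x, snd x))" .
    qed
    then have "indep_var borel ((\<lambda>u. u * a) \<circ> fst) borel ((\<lambda>v. v * b) \<circ> snd)"
      by (rule indep_var_compose) auto
    then have "distributed ?P lborel (\<lambda>p. fst p * a + snd p * b)
        (normal_density (0 + 0) (sqrt (\<bar>a\<bar>\<^sup>2 + \<bar>b\<bar>\<^sup>2)))"
      using g False by (intro add_indep_normal) (auto simp: comp_def gaussian_functional_def)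
    then show ?thesis using False by (simp add: gaussian_functional_def)
  qed
qed

lemma gaussian_entry_complex_pair:
  "gaussian_entry (std_normal \<Otimes>\<^sub>M std_normal) (\<lambda>(u, v). Complex (u / sqrt 2) (v / sqrt 2))"
  unfolding gaussian_entry_def
proof (intro conjI exI allI)
  interpret S: prob_space std_normal by (rule prob_space_std_normal)
  interpret pair_prob_space std_normal std_normal ..
  show "prob_space (std_normal \<Otimes>\<^sub>M std_normal)" by (rule prob_space_axioms)
  have [measurable]: "fst \<in> borel_measurable (std_normal \<Otimes>\<^sub>M std_normal)"
     "snd \<in> borel_measurable (std_normal \<Otimes>\<^sub>M std_normal)"
    using distributed_pair_std_normal by (simp_all add: distributed_def)
  have "(\<lambda>p. complex_of_real (fst p / sqrt 2) + \<i> * complex_of_real (snd p / sqrt 2))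
      \<in> borel_measurable (std_normal \<Otimes>\<^sub>M std_normal)"
    by measurable
  also have "(\<lambda>p. complex_of_real (fst p / sqrt 2) + \<i> * complex_of_real (snd p / sqrt 2))
    = (\<lambda>(u, v). Complex (u / sqrt 2) (v / sqrt 2))"
    by (auto simp: complex_eq_iff)
  finally show "(\<lambda>(u, v). Complex (u / sqrt 2) (v / sqrt 2)) \<in> borel_measurable (std_normal \<Otimes>\<^sub>M std_normal)" .
  fix c
  have "(\<lambda>p. Re ((case p of (u, v) \<Rightarrow> Complex (u / sqrt 2) (v / sqrt 2)) * c))
     = (\<lambda>p. fst p * (Re c / sqrt 2) + snd p * (- Im c / sqrt 2))"
    by (auto simp: fun_eq_iff)
  moreover have "sqrt ((Re c / sqrt 2)\<^sup>2 + (- Im c / sqrt 2)\<^sup>2) = cmod c / sqrt 2"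
    by (simp add: cmod_def power_divide add_divide_distrib[symmetric] real_sqrt_divide)
  ultimately show "gaussian_functional (std_normal \<Otimes>\<^sub>M std_normal)
      (\<lambda>p. Re ((case p of (u, v) \<Rightarrow> Complex (u / sqrt 2) (v / sqrt 2)) * c)) (cmod c / sqrt 2)"
    using gaussian_functional_pair[of "Re c / sqrt 2" "- Im c / sqrt 2"] by simp
  show "(cmod c / sqrt 2)\<^sup>2 + (cmod (- \<i> * c) / sqrt 2)\<^sup>2 = (cmod c)\<^sup>2"
    by (simp add: norm_mult power_divide)
qed

subsection \<open>Hierarchical supports\<close>

lemma block_index_less: "i < N \<Longrightarrow> j < n \<Longrightarrow> i * n + j < N * (n::nat)"
proof -
  assume "i < N" "j < n"
  then have "i * n + j < Suc i * n" by simp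
  also have "\<dots> \<le> N * n" using \<open>i < N\<close> by (intro mult_le_mono1) simp
  finally show ?thesis .
qed

lemma hi_sparse_iff:
  "hi_sparse N n s \<sigma> x \<longleftrightarrow>
     card {i. i < N \<and> (\<exists>j<n. x $ (i * n + j) \<noteq> 0)} \<le> s \<and>
     (\<forall>i<N. card {j. j < n \<and> x $ (i * n + j) \<noteq> 0} \<le> \<sigma>)"
proof -
  have nz: "block n x i \<noteq> 0\<^sub>v n \<longleftrightarrow> (\<exists>j<n. x $ (i * n + j) \<noteq> 0)" for i
    by (auto simp: block_def vec_eq_iff)
  have bl: "{j. j < n \<and> block n x i $ j \<noteq> 0} = {j. j < n \<and> x $ (i * n + j) \<noteq> 0}" for i
    by (auto simp: block_def)
  have "card {j. j < n \<and> x $ (i * n + j) \<noteq> 0} = 0" if "\<not> (\<exists>j<n. x $ (i * n + j) \<noteq> 0)" for i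
    using that by (simp add: card_eq_0_iff)
  then have "card {j. j < n \<and> x $ (i * n + j) \<noteq> 0} \<le> \<sigma>" if "\<not> (\<exists>j<n. x $ (i * n + j) \<noteq> 0)" for i
    using that by (metis le0)
  then show ?thesis unfolding hi_sparse_def nz bl by blast
qed

text \<open>Sparsity depends on the zero pattern alone. This serves both the embedding of real
  vectors into complex ones and the approximation that retains zero entries.\<close>

lemma hi_sparse_mono:
  assumes x: "hi_sparse N n s \<sigma> x" and y: "\<And>k. k < N * n \<Longrightarrow> y $ k \<noteq> 0 \<Longrightarrow> x $ k \<noteq> 0"
  shows "hi_sparse N n s \<sigma> y"
  unfolding hi_sparse_iff
proof (intro conjI allI impI)
  have y': "y $ (i * n + j) \<noteq> 0 \<Longrightarrow> x $ (i * n + j) \<noteq> 0" if "i < N" "j < n" for i j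
    using y block_index_less[OF that] .
  have "card {i. i < N \<and> (\<exists>j<n. y $ (i * n + j) \<noteq> 0)} \<le> card {i. i < N \<and> (\<exists>j<n. x $ (i * n + j) \<noteq> 0)}"
    using y' by (intro card_mono) auto
  then show "card {i. i < N \<and> (\<exists>j<n. y $ (i * n + j) \<noteq> 0)} \<le> s"
    using x by (simp add: hi_sparse_iff)
  fix i assume i: "i < N"
  have "card {j. j < n \<and> y $ (i * n + j) \<noteq> 0} \<le> card {j. j < n \<and> x $ (i * n + j) \<noteq> 0}"
    using y'[OF i] by (intro card_mono) auto
  then show "card {j. j < n \<and> y $ (i * n + j) \<noteq> 0} \<le> \<sigma>"
    using x i unfolding hi_sparse_iff by (meson order_trans)
qed

text \<open>Blocks and entries are chosen in exact numbers s and \<sigma>, so that the choices are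
  counted by binomial coefficients. Smaller supports are covered by enlargement, for which there is
  room when s <= N and \<sigma> <= n.\<close>

definition hi_supports :: "nat \<Rightarrow> nat \<Rightarrow> nat \<Rightarrow> nat \<Rightarrow> nat set set" where
  "hi_supports N n s \<sigma> = (\<lambda>(S, Q). (\<lambda>(i, j). i * n + j) ` Sigma S Q) `
     (SIGMA S:{S. S \<subseteq> {..<N} \<and> card S = s}. PiE S (\<lambda>_. {Q. Q \<subseteq> {..<n} \<and> card Q = \<sigma>}))"

lemma hi_supportsE:
  assumes "T \<in> hi_supports N n s \<sigma>"
  obtains S Q where "S \<subseteq> {..<N}" "card S = s"
    "\<And>i. i \<in> S \<Longrightarrow> Q i \<subseteq> {..<n} \<and> card (Q i) = \<sigma>"
    "T = (\<lambda>(i, j). i * n + j) ` Sigma S Q"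
proof -
  obtain p where p: "p \<in> (SIGMA S:{S. S \<subseteq> {..<N} \<and> card S = s}. PiE S (\<lambda>_. {Q. Q \<subseteq> {..<n} \<and> card Q = \<sigma>}))"
    and T: "T = (\<lambda>(S, Q). (\<lambda>(i, j). i * n + j) ` Sigma S Q) p"
    using assms unfolding hi_supports_def by (rule imageE)
  obtain S Q where [simp]: "p = (S, Q)" by (cases p)
  have Q: "Q \<in> PiE S (\<lambda>_. {Q. Q \<subseteq> {..<n} \<and> card Q = \<sigma>})" using p by simp
  show thesis
    by (rule that[of S Q]) (use p T PiE_mem[OF Q] in simp_all)
qed

lemma hi_supports_subset:
  assumes "T \<in> hi_supports N n s \<sigma>"
  shows "T \<subseteq> {..<N * n}"
proof
  fix k assume k: "k \<in> T"
  obtain S Q where S: "S \<subseteq> {..<N}" and Q: "\<And>i. i \<in> S \<Longrightarrow> Q i \<subseteq> {..<n} \<and> card (Q i) = \<sigma>"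
    and T: "T = (\<lambda>(i, j). i * n + j) ` Sigma S Q"
    using assms by (rule hi_supportsE) blast
  obtain i j where "i \<in> S" "j \<in> Q i" "k = i * n + j" using k unfolding T by auto
  then show "k \<in> {..<N * n}" using block_index_less[of i N j n] S Q by blast
qed

lemma card_hi_support_le:
  assumes "T \<in> hi_supports N n s \<sigma>"
  shows "card T \<le> s * \<sigma>"
proof -
  obtain S Q where S: "S \<subseteq> {..<N}" "card S = s"
    and Q: "\<And>i. i \<in> S \<Longrightarrow> Q i \<subseteq> {..<n} \<and> card (Q i) = \<sigma>"
    and T: "T = (\<lambda>(i, j). i * n + j) ` Sigma S Q"
    using assms by (rule hi_supportsE) blast
  have fin: "finite S" "\<forall>i\<in>S. finite (Q i)"
    using S Q finite_subset[OF _ finite_lessThan] by blast+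
  have "card T \<le> card (Sigma S Q)" unfolding T using fin by (intro card_image_le) auto
  also have "\<dots> = s * \<sigma>" using fin Q S by (simp add: card_SigmaI)
  finally show ?thesis .
qed

lemma hi_supports_index_finite:
  "finite (SIGMA S:{S. S \<subseteq> {..<N::nat} \<and> card S = s}. PiE S (\<lambda>_. {Q. Q \<subseteq> {..<n::nat} \<and> card Q = \<sigma>}))"
  by (intro finite_SigmaI finite_PiE) (auto intro: finite_subset)

lemma finite_hi_supports: "finite (hi_supports N n s \<sigma>)"
  unfolding hi_supports_def by (intro finite_imageI hi_supports_index_finite)

lemma card_hi_supports_le: "card (hi_supports N n s \<sigma>) \<le> (N choose s) * (n choose \<sigma>) ^ s"
proof -
  have "card (hi_supports N n s \<sigma>) \<le> card (SIGMA S:{S. S \<subseteq> {..<N::nat} \<and> card S = s}.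
      PiE S (\<lambda>_. {Q. Q \<subseteq> {..<n} \<and> card Q = \<sigma>}))"
    unfolding hi_supports_def by (intro card_image_le hi_supports_index_finite)
  also have "\<dots> = (\<Sum>S\<in>{S. S \<subseteq> {..<N} \<and> card S = s}. card (PiE S (\<lambda>_. {Q. Q \<subseteq> {..<n} \<and> card Q = \<sigma>})))"
    by (intro card_SigmaI) (auto intro!: finite_PiE intro: finite_subset)
  also have "\<dots> = (\<Sum>S\<in>{S. S \<subseteq> {..<N} \<and> card S = s}. (n choose \<sigma>) ^ s)"
    by (intro sum.cong refl) (auto simp: card_PiE n_subsets finite_subset)
  also have "\<dots> = (N choose s) * (n choose \<sigma>) ^ s" by (simp add: n_subsets)
  finally show ?thesis .
qed

lemma hi_sparse_supported:
  assumes x: "hi_sparse N n s \<sigma> x" and s: "s \<le> N" and \<sigma>: "\<sigma> \<le> n"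
  shows "\<exists>T\<in>hi_supports N n s \<sigma>. \<forall>k<N * n. x $ k \<noteq> 0 \<longrightarrow> k \<in> T"
proof -
  let ?S = "{i. i < N \<and> (\<exists>j<n. x $ (i * n + j) \<noteq> 0)}" and ?Q = "\<lambda>i. {j. j < n \<and> x $ (i * n + j) \<noteq> 0}"
  obtain S where S: "?S \<subseteq> S" "S \<subseteq> {..<N}" "card S = s"
    using exists_subset_between[of ?S s "{..<N}"] x s by (auto simp: hi_sparse_iff)
  have "\<forall>i\<in>S. \<exists>Q. ?Q i \<subseteq> Q \<and> Q \<subseteq> {..<n} \<and> card Q = \<sigma>"
    using x \<sigma> S(2) by (intro ballI exists_subset_between) (auto simp: hi_sparse_iff)
  then obtain Q where Q: "\<And>i. i \<in> S \<Longrightarrow> ?Q i \<subseteq> Q i \<and> Q i \<subseteq> {..<n} \<and> card (Q i) = \<sigma>"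
    unfolding bchoice_iff by blast
  define T where "T = (\<lambda>(i, j). i * n + j) ` Sigma S (restrict Q S)"
  have "restrict Q S \<in> PiE S (\<lambda>_. {Q. Q \<subseteq> {..<n} \<and> card Q = \<sigma>})" using Q by simp
  then have "T \<in> hi_supports N n s \<sigma>"
    unfolding T_def hi_supports_def using S by (intro image_eqI[where x = "(S, restrict Q S)"]) simp_all
  moreover have "k \<in> T" if k: "k < N * n" "x $ k \<noteq> 0" for k
  proof -
    have n: "0 < n" using k(1) by (cases n) auto
    define i where "i = k div n"
    define j where "j = k mod n"
    have kij: "k = i * n + j" and j: "j < n" and i: "i < N"
      using n k(1) by (simp_all add: i_def j_def less_mult_imp_div_less)
    then have iS: "i \<in> S" using S(1) k(2) by blast
    then have "j \<in> Q i" using Q[OF iS] j k(2) kij by blast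
    then show ?thesis unfolding T_def kij using iS by (intro image_eqI[where x = "(i, j)"]) auto
  qed
  ultimately show ?thesis by blast
qed

section \<open>Bounds for binomial coefficients\<close>

lemma power_div_fact_le_exp:
  fixes x :: real
  assumes "0 \<le> x"
  shows "x ^ k / fact k \<le> exp x"
proof -
  have "(\<Sum>n\<in>{k}. inverse (fact n) * x ^ n) \<le> (\<Sum>n. inverse (fact n) * x ^ n)"
    using assms summable_exp[of x] by (intro sum_le_suminf) auto
  then show ?thesis by (simp add: exp_def divide_inverse mult.commute)
qed

text \<open>The familiar bound (e n / k)^k in exponential form. It follows from n^k / k! = (n / k)^k
  * (k^k / k!), where k^k / k! is one term of the series of e^k.\<close>

lemma binomial_le_exp:
  assumes "1 \<le> k" "k \<le> n"
  shows "real (n choose k) \<le> exp (real k * (1 + ln (real n / real k)))"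
proof -
  have "real (n choose k) * fact k \<le> real n ^ k"
    using binomial_fact_pow[of n k] by (metis of_nat_fact of_nat_le_iff of_nat_mult of_nat_power)
  then have "real (n choose k) \<le> real n ^ k / fact k" by (simp add: field_simps)
  also have "\<dots> = (real n / real k) ^ k * (real k ^ k / fact k)"
    using assms by (simp add: power_divide)
  also have "\<dots> \<le> (real n / real k) ^ k * exp (real k)"
    by (intro mult_left_mono power_div_fact_le_exp) auto
  also have "(real n / real k) ^ k = exp (real k * ln (real n / real k))"
    using assms by (simp add: exp_of_nat_mult)
  finally show ?thesis by (simp add: exp_add[symmetric] algebra_simps)
qed

subsection \<open>The restricted isometry constant\<close>

lemma l2_norm_sq: "(l2_norm x)\<^sup>2 = (\<Sum>k<dim_vec x. (norm (x $ k))\<^sup>2)"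
  by (simp add: l2_norm_def L2_set_def sum_nonneg)

lemma l2_norm_sq_smult_mat:
  assumes "x \<in> carrier_vec d"
  shows "(l2_norm ((c \<cdot>\<^sub>m Matrix.mat m d A) *\<^sub>v x))\<^sup>2 =
    (norm c)\<^sup>2 * (\<Sum>i<m. (norm (\<Sum>k<d. A (i, k) * x $ k))\<^sup>2)"
proof -
  have "((c \<cdot>\<^sub>m Matrix.mat m d A) *\<^sub>v x) $ i = c * (\<Sum>k<d. A (i, k) * x $ k)" if "i < m" for i
    using assms that
    by (auto simp: scalar_prod_def atLeast0LessThan sum_distrib_left mult.assoc intro!: sum.cong)
  then have "(norm (((c \<cdot>\<^sub>m Matrix.mat m d A) *\<^sub>v x) $ i))\<^sup>2 = (norm c)\<^sup>2 * (norm (\<Sum>k<d. A (i, k) * x $ k))\<^sup>2"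
    if "i < m" for i
    using that by (simp only: norm_mult power_mult_distrib)
  moreover have "dim_vec ((c \<cdot>\<^sub>m Matrix.mat m d A) *\<^sub>v x) = m" by simp
  ultimately show ?thesis
    unfolding l2_norm_sq sum_distrib_left by (intro sum.cong) (simp_all only: lessThan_iff)
qed

text \<open>The infimum is itself an admissible bound, and the admissible bounds are upward closed.
  The equivalence replaces the constant by inequalities for individual vectors.\<close>

lemma hirip_const_le_iff:
  assumes M: "M \<in> carrier_mat m (N * n)" and \<delta>: "0 \<le> \<delta>"
  shows "hirip_const N n s \<sigma> M \<le> \<delta> \<longleftrightarrow> hirip_bound N n s \<sigma> M \<delta>"
proof
  assume le: "hirip_const N n s \<sigma> M \<le> \<delta>"
  show "hirip_bound N n s \<sigma> M \<delta>"
    unfolding hirip_bound_def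
  proof (intro ballI impI)
    fix x :: "'a Matrix.vec" assume x: "x \<in> carrier_vec (N * n)" "hi_sparse N n s \<sigma> x"
    let ?h = "hirip_const N n s \<sigma> M"
    have "(1 - ?h) * (l2_norm x)\<^sup>2 \<le> (l2_norm (M *\<^sub>v x))\<^sup>2" "(l2_norm (M *\<^sub>v x))\<^sup>2 \<le> (1 + ?h) * (l2_norm x)\<^sup>2"
      using hirip_const_is_least(2)[OF M, of s \<sigma>] x by (auto simp: hirip_bound_def)
    moreover have "(1 - \<delta>) * (l2_norm x)\<^sup>2 \<le> (1 - ?h) * (l2_norm x)\<^sup>2"
      "(1 + ?h) * (l2_norm x)\<^sup>2 \<le> (1 + \<delta>) * (l2_norm x)\<^sup>2"
      using le by (auto intro!: mult_right_mono)
    ultimately show "(1 - \<delta>) * (l2_norm x)\<^sup>2 \<le> (l2_norm (M *\<^sub>v x))\<^sup>2 \<and>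
        (l2_norm (M *\<^sub>v x))\<^sup>2 \<le> (1 + \<delta>) * (l2_norm x)\<^sup>2"
      by linarith
  qed
qed (rule hirip_const_is_least(3)[OF M \<delta>])

text \<open>A sparse vector lies on some T from the family, so its norm and the rows of its image
  reduce to sums over T. The scalar 1 / sqrt m turns the defect into m times the difference of the
  squared norms.\<close>

lemma hirip_bound_of_quad_defect:
  fixes a :: "nat \<times> nat \<Rightarrow> complex"
  assumes s: "s \<le> N" and \<sigma>: "\<sigma> \<le> n" and m: "0 < m"
    and q: "\<And>T x. T \<in> hi_supports N n s \<sigma> \<Longrightarrow>
      \<bar>quad_defect m T (\<lambda>i k. a (i, k)) x\<bar> \<le> \<delta> * real m * (\<Sum>k\<in>T. (cmod (x k))\<^sup>2)"
  shows "hirip_bound N n s \<sigma> (complex_of_real (1 / sqrt (real m)) \<cdot>\<^sub>m Matrix.mat m (N * n) a) \<delta>"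
  unfolding hirip_bound_def
proof (intro ballI impI)
  fix x :: "complex Matrix.vec" assume x: "x \<in> carrier_vec (N * n)" and sp: "hi_sparse N n s \<sigma> x"
  obtain T where T: "T \<in> hi_supports N n s \<sigma>" and xT: "\<And>k. k < N * n \<Longrightarrow> x $ k \<noteq> 0 \<Longrightarrow> k \<in> T"
    using hi_sparse_supported[OF sp s \<sigma>] by blast
  note Tsub = hi_supports_subset[OF T]
  define \<nu> where "\<nu> = (l2_norm x)\<^sup>2"
  define \<eta> where "\<eta> = (l2_norm ((complex_of_real (1 / sqrt (real m)) \<cdot>\<^sub>m Matrix.mat m (N * n) a) *\<^sub>v x))\<^sup>2"
  have \<nu>: "\<nu> = (\<Sum>k\<in>T. (cmod (x $ k))\<^sup>2)"
    using x Tsub xT unfolding \<nu>_def l2_norm_sq by (intro sum.mono_neutral_right) auto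
  have row: "(\<Sum>k<N * n. a (i, k) * x $ k) = (\<Sum>k\<in>T. a (i, k) * x $ k)" for i
    using Tsub xT by (intro sum.mono_neutral_right) auto
  have "real m * \<eta> = (\<Sum>i<m. (cmod (\<Sum>k\<in>T. a (i, k) * x $ k))\<^sup>2)"
    using m unfolding \<eta>_def l2_norm_sq_smult_mat[OF x] row
    by (simp add: norm_divide power_divide)
  then have "quad_defect m T (\<lambda>i k. a (i, k)) (\<lambda>k. x $ k) = real m * (\<eta> - \<nu>)"
    by (simp add: quad_defect_def \<nu> right_diff_distrib)
  then have "real m * \<bar>\<eta> - \<nu>\<bar> \<le> real m * (\<delta> * \<nu>)"
    using q[OF T, of "\<lambda>k. x $ k"] by (simp add: \<nu> abs_mult mult_ac)
  then have "\<bar>\<eta> - \<nu>\<bar> \<le> \<delta> * \<nu>" using m by simp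
  then show "(1 - \<delta>) * (l2_norm x)\<^sup>2 \<le> (l2_norm ((complex_of_real (1 / sqrt (real m)) \<cdot>\<^sub>m Matrix.mat m (N * n) a) *\<^sub>v x))\<^sup>2 \<and>
    (l2_norm ((complex_of_real (1 / sqrt (real m)) \<cdot>\<^sub>m Matrix.mat m (N * n) a) *\<^sub>v x))\<^sup>2 \<le> (1 + \<delta>) * (l2_norm x)\<^sup>2"
    unfolding \<nu>_def[symmetric] \<eta>_def[symmetric] left_diff_distrib distrib_right by linarith
qed

lemma hirip_bound_of_real:
  fixes A :: "nat \<times> nat \<Rightarrow> real"
  assumes "hirip_bound N n s \<sigma> (complex_of_real c \<cdot>\<^sub>m Matrix.mat m (N * n) (\<lambda>p. complex_of_real (A p))) \<delta>"
  shows "hirip_bound N n s \<sigma> (c \<cdot>\<^sub>m Matrix.mat m (N * n) A) \<delta>"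
  unfolding hirip_bound_def
proof (intro ballI impI)
  fix x :: "real Matrix.vec" assume x: "x \<in> carrier_vec (N * n)" and sp: "hi_sparse N n s \<sigma> x"
  define y where "y = Matrix.vec (N * n) (\<lambda>k. complex_of_real (x $ k))"
  have y: "y \<in> carrier_vec (N * n)" by (simp add: y_def)
  have sy: "hi_sparse N n s \<sigma> y" by (rule hi_sparse_mono[OF sp]) (simp add: y_def)
  have "(l2_norm y)\<^sup>2 = (l2_norm x)\<^sup>2" using x by (simp add: l2_norm_sq y_def)
  moreover have "(l2_norm ((complex_of_real c \<cdot>\<^sub>m Matrix.mat m (N * n) (\<lambda>p. complex_of_real (A p))) *\<^sub>v y))\<^sup>2
    = (l2_norm ((c \<cdot>\<^sub>m Matrix.mat m (N * n) A) *\<^sub>v x))\<^sup>2"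
  proof -
    have "(\<Sum>k<N * n. complex_of_real (A (i, k)) * y $ k) = complex_of_real (\<Sum>k<N * n. A (i, k) * x $ k)" for i
      by (simp add: y_def)
    then show ?thesis unfolding l2_norm_sq_smult_mat[OF x] l2_norm_sq_smult_mat[OF y]
      by (simp only: norm_of_real real_norm_def)
  qed
  ultimately show "(1 - \<delta>) * (l2_norm x)\<^sup>2 \<le> (l2_norm ((c \<cdot>\<^sub>m Matrix.mat m (N * n) A) *\<^sub>v x))\<^sup>2 \<and>
    (l2_norm ((c \<cdot>\<^sub>m Matrix.mat m (N * n) A) *\<^sub>v x))\<^sup>2 \<le> (1 + \<delta>) * (l2_norm x)\<^sup>2"
    using assms y sy unfolding hirip_bound_def by metis
qed

text \<open>Vectors with entries in a countable dense set containing 0 suffice, because the approximation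
  can keep the zero entries and hence the sparsity pattern.\<close>
lemma sets_hirip_const_le:
  fixes \<mu> :: "'a::{real_normed_field, second_countable_topology} measure"
  defines "M \<equiv> \<lambda>m d. iid_entries \<mu> m d"
  assumes \<mu>: "sets \<mu> = sets borel" and \<delta>: "0 \<le> \<delta>"
  shows "{A \<in> space (M m (N * n)). hirip_const N n s \<sigma> (c \<cdot>\<^sub>m Matrix.mat m (N * n) A) \<le> \<delta>} \<in> sets (M m (N * n))"
proof -
  let ?d = "N * n"
  define P where "P = M m ?d"
  obtain D :: "'a set" where D: "countable D" "\<And>X. open X \<Longrightarrow> X \<noteq> {} \<Longrightarrow> \<exists>z\<in>D. z \<in> X"
    using countable_dense_exists[where 'a = 'a] by blast
  define g where "g = from_nat_into (insert 0 D)"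
  have g: "range g = insert 0 D" unfolding g_def using D(1) by (intro range_from_nat_into) auto
  have approx: "\<exists>p. dist (g p) z < inverse (real (Suc q)) \<and> (z = 0 \<longrightarrow> g p = 0)" for z q
  proof (cases "z = 0")
    case True
    then show ?thesis using g by (metis dist_self insertI1 inverse_positive_iff_positive of_nat_0_less_iff rangeE zero_less_Suc)
  next
    case False
    have "\<exists>w\<in>D. w \<in> ball z (inverse (real (Suc q)))" by (intro D(2)) auto
    then obtain w where "w \<in> range g" "dist z w < inverse (real (Suc q))" unfolding g by auto
    then show ?thesis using False by (auto simp: dist_commute)
  qed
  \<comment> \<open>Lists of naturals form a countable type, so quantification over \<open>l\<close>
    is a countable intersection of events. A list shorter than the dimension does no harm:
    \<open>l ! k\<close> is then still some natural number, and the entry still lies in the range of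
    \<open>g\<close>.\<close>
  define y where "y l = Matrix.vec ?d (\<lambda>k. g (l ! k))" for l :: "nat list"
  define H where "H A x \<longleftrightarrow>
      (1 - \<delta>) * (\<Sum>k<?d. (norm (x $ k))\<^sup>2) \<le> (norm c)\<^sup>2 * (\<Sum>i<m. (norm (\<Sum>k<?d. A (i, k) * x $ k))\<^sup>2) \<and>
      (norm c)\<^sup>2 * (\<Sum>i<m. (norm (\<Sum>k<?d. A (i, k) * x $ k))\<^sup>2) \<le> (1 + \<delta>) * (\<Sum>k<?d. (norm (x $ k))\<^sup>2)"
    for A :: "nat \<times> nat \<Rightarrow> 'a" and x
  have bound: "hirip_bound N n s \<sigma> (c \<cdot>\<^sub>m Matrix.mat m ?d A) \<delta> \<longleftrightarrow>
      (\<forall>x\<in>carrier_vec ?d. hi_sparse N n s \<sigma> x \<longrightarrow> H A x)" for A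
    unfolding hirip_bound_def
  proof (intro ball_cong refl imp_cong)
    fix x :: "'a Matrix.vec" assume x: "x \<in> carrier_vec ?d"
    have "(l2_norm x)\<^sup>2 = (\<Sum>k<?d. (norm (x $ k))\<^sup>2)" using x by (simp add: l2_norm_sq)
    then show "((1 - \<delta>) * (l2_norm x)\<^sup>2 \<le> (l2_norm ((c \<cdot>\<^sub>m Matrix.mat m ?d A) *\<^sub>v x))\<^sup>2 \<and>
        (l2_norm ((c \<cdot>\<^sub>m Matrix.mat m ?d A) *\<^sub>v x))\<^sup>2 \<le> (1 + \<delta>) * (l2_norm x)\<^sup>2) = H A x"
      by (simp only: H_def l2_norm_sq_smult_mat[OF x])
  qed
  have iff: "hirip_const N n s \<sigma> (c \<cdot>\<^sub>m Matrix.mat m ?d A) \<le> \<delta> \<longleftrightarrow> (\<forall>l. hi_sparse N n s \<sigma> (y l) \<longrightarrow> H A (y l))" for A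
  proof -
    have "H A x" if all: "\<forall>l. hi_sparse N n s \<sigma> (y l) \<longrightarrow> H A (y l)"
      and x: "x \<in> carrier_vec ?d" and sp: "hi_sparse N n s \<sigma> x" for x
    proof -
      define f where "f q k = (SOME p. dist (g p) (x $ k) < inverse (real (Suc q)) \<and> (x $ k = 0 \<longrightarrow> g p = 0))" for q k
      have f: "dist (g (f q k)) (x $ k) < inverse (real (Suc q)) \<and> (x $ k = 0 \<longrightarrow> g (f q k) = 0)" for q k
        unfolding f_def by (rule someI_ex[OF approx])
      define z where "z q = y (map (f q) [0..<?d])" for q
      have z: "z q $ k = g (f q k)" if "k < ?d" for q k using that by (simp add: z_def y_def)
      have sz: "hi_sparse N n s \<sigma> (z q)" for q
        by (rule hi_sparse_mono[OF sp]) (use f z in metis)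
      have Hz: "H A (z q)" for q using all sz by (simp add: z_def)
      have lim: "(\<lambda>q. z q $ k) \<longlonglongrightarrow> x $ k" if k: "k < ?d" for k
      proof (rule metric_tendsto_imp_tendsto[OF LIMSEQ_inverse_real_of_nat])
        show "\<forall>\<^sub>F q in sequentially. dist (z q $ k) (x $ k) \<le> dist (inverse (real (Suc q))) 0"
          using f k by (auto simp: z less_imp_le intro!: always_eventually)
      qed
      have l1: "(\<lambda>q. \<Sum>k<?d. (norm (z q $ k))\<^sup>2) \<longlonglongrightarrow> (\<Sum>k<?d. (norm (x $ k))\<^sup>2)"
        by (intro tendsto_intros lim) auto
      have l2: "(\<lambda>q. (norm c)\<^sup>2 * (\<Sum>i<m. (norm (\<Sum>k<?d. A (i, k) * z q $ k))\<^sup>2))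
          \<longlonglongrightarrow> (norm c)\<^sup>2 * (\<Sum>i<m. (norm (\<Sum>k<?d. A (i, k) * x $ k))\<^sup>2)"
        by (intro tendsto_intros lim) auto
      show ?thesis unfolding H_def
      proof (intro conjI)
        show "(1 - \<delta>) * (\<Sum>k<?d. (norm (x $ k))\<^sup>2) \<le> (norm c)\<^sup>2 * (\<Sum>i<m. (norm (\<Sum>k<?d. A (i, k) * x $ k))\<^sup>2)"
          by (rule LIMSEQ_le[OF tendsto_mult_left[OF l1] l2]) (use Hz in \<open>auto simp: H_def\<close>)
        show "(norm c)\<^sup>2 * (\<Sum>i<m. (norm (\<Sum>k<?d. A (i, k) * x $ k))\<^sup>2) \<le> (1 + \<delta>) * (\<Sum>k<?d. (norm (x $ k))\<^sup>2)"
          by (rule LIMSEQ_le[OF l2 tendsto_mult_left[OF l1]]) (use Hz in \<open>auto simp: H_def\<close>)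
      qed
    qed
    moreover have "y l \<in> carrier_vec ?d" for l by (simp add: y_def)
    ultimately show ?thesis
      by (subst hirip_const_le_iff[where m = m]) (auto simp: \<delta> bound)
  qed
  have [measurable]: "(\<lambda>A. A (i, k)) \<in> borel_measurable P" if "i \<in> {..<m}" "k \<in> {..<?d}" for i k
  proof -
    have "(\<lambda>A. A (i, k)) \<in> P \<rightarrow>\<^sub>M \<mu>"
      unfolding P_def M_def iid_entries_def using that by (intro measurable_component_singleton) auto
    then show ?thesis by (simp add: measurable_cong_sets[OF refl \<mu>])
  qed
  have "{A \<in> space P. \<forall>l. hi_sparse N n s \<sigma> (y l) \<longrightarrow> H A (y l)} \<in> sets P"
    unfolding H_def by measurable
  then show ?thesis unfolding iff P_def .
qed

section \<open>Union bound and probability estimate\<close>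

text \<open>The left side is the number of supports, times the bound on the net, times the factor 4
  from the tail of one point. It is put in the form of the sample size condition so that the union
  bound becomes a comparison of exponents.\<close>

lemma card_hi_supports_net_le:
  assumes s: "1 \<le> s" "s \<le> N" and \<sigma>: "1 \<le> \<sigma>" "\<sigma> \<le> n"
  shows "real (card (hi_supports N n s \<sigma>)) * 2304 ^ (s * \<sigma>) * 4 \<le>
    exp (16 * (real s * ln (real N / real s) + real s * real \<sigma> * ln (exp 1 * real n / real \<sigma>)))"
proof -
  define L where "L = ln (exp 1 * real n / real \<sigma>)"
  define k where "k = real s * real \<sigma>"
  define U where "U = real s * ln (real N / real s)"
  have L: "L = 1 + ln (real n / real \<sigma>)" using \<sigma> by (simp add: L_def ln_mult ln_div)
  have L1: "1 \<le> L" using \<sigma> unfolding L by simp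
  have U0: "0 \<le> U" using s unfolding U_def by (intro mult_nonneg_nonneg ln_ge_zero) auto
  have sk: "real s \<le> k" "1 \<le> k"
  proof -
    show "real s \<le> k" using \<sigma> s by (simp add: k_def)
    then show "1 \<le> k" using s by linarith
  qed
  have kL: "k \<le> k * L" using sk L1 by simp
  have e2: "(2::real) \<le> exp 1" using exp_ge_add_one_self[of 1] by simp
  have e4: "(4::real) \<le> exp 2"
    using power_mono[OF e2, of 2] by (simp add: exp_of_nat_mult[symmetric])
  have "(2304::real) \<le> 2 ^ 12" by simp
  also have "\<dots> \<le> exp 1 ^ 12" by (rule power_mono[OF e2]) simp
  finally have "(2304::real) ^ (s * \<sigma>) \<le> (exp 12) ^ (s * \<sigma>)"
    by (intro power_mono) (simp_all add: exp_of_nat_mult[symmetric])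
  then have net: "(2304::real) ^ (s * \<sigma>) \<le> exp (12 * k)"
    by (simp add: k_def exp_of_nat_mult[symmetric] mult_ac)
  have "real (card (hi_supports N n s \<sigma>)) \<le> real (N choose s) * real (n choose \<sigma>) ^ s"
    using card_hi_supports_le[of N n s \<sigma>] by (metis of_nat_le_iff of_nat_mult of_nat_power)
  also have "\<dots> \<le> exp (real s * (1 + ln (real N / real s))) * exp (real \<sigma> * (1 + ln (real n / real \<sigma>))) ^ s"
    by (intro mult_mono power_mono binomial_le_exp s \<sigma>) auto
  also have "\<dots> = exp (real s + U + k * L)"
    by (simp add: exp_of_nat_mult[symmetric] exp_add[symmetric] L U_def k_def algebra_simps)
  finally have "real (card (hi_supports N n s \<sigma>)) * 2304 ^ (s * \<sigma>) * 4 \<le> exp (real s + U + k * L) * exp (12 * k) * exp 2"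
    using net e4 by (intro mult_mono) auto
  \<comment> \<open>With 1 <= L and 1 <= k, the terms s, k L, 12 k and 2 are at most 1, 1, 12 and 2
    times k L. This is the origin of 16 = 1 + 1 + 12 + 2.\<close>
  also have "\<dots> \<le> exp (16 * (U + k * L))"
    unfolding exp_add[symmetric] exp_le_cancel_iff distrib_left using sk kL U0 by linarith
  finally show ?thesis by (simp add: U_def k_def L_def)
qed

text \<open>The conclusion is phrased with an exceptional set because that set is a finite union of
  explicit events, and so measurable at once. The bound outside it concerns the matrix with entries
  \<open>e (A p)\<close>, from which real and complex matrices are both served.\<close>

lemma gaussian_hirip_exceptional_set:
  fixes \<mu> :: "'a measure"
  defines "M \<equiv> \<lambda>m d. iid_entries \<mu> m d"
  assumes e: "gaussian_entry \<mu> e"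
    and m: "0 < m" and s: "1 \<le> s" "s \<le> N" and \<sigma>: "1 \<le> \<sigma>" "\<sigma> \<le> n"
    and \<delta>: "0 < \<delta>" "\<delta> < 1" and \<epsilon>: "0 < \<epsilon>" "\<epsilon> < 1"
    and large: "real m \<ge> 1024 / \<delta>\<^sup>2 * (real s * ln (real N / real s)
      + real s * real \<sigma> * ln (exp 1 * real n / real \<sigma>) + ln (1 / \<epsilon>))"
  shows "\<exists>B\<in>sets (M m (N * n)). measure (M m (N * n)) B \<le> \<epsilon> \<and> (\<forall>A\<in>space (M m (N * n)) - B.
    hirip_bound N n s \<sigma> (complex_of_real (1 / sqrt (real m)) \<cdot>\<^sub>m Matrix.mat m (N * n) (\<lambda>p. e (A p))) \<delta>)"
proof -
  define P where "P = M m (N * n)"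
  \<comment> \<open>The passage from the net to all vectors loses a factor 2.\<close>
  define t where "t = \<delta> / 2"
  define bad where "bad T f = {A \<in> space P. t * (real m * (\<Sum>k\<in>T. (cmod (gauss_int f k))\<^sup>2)) <
      \<bar>quad_defect m T (\<lambda>i k. e (A (i, k))) (gauss_int f)\<bar>}" for T f
  define I where "I = (SIGMA T:hi_supports N n s \<sigma>. lattice_net T (8 * card T))"
  define B where "B = (\<Union>p\<in>I. bad (fst p) (snd p))"
  define q where "q = 4 * exp (- (t\<^sup>2 * m / 16))"
  have em: "e \<in> borel_measurable \<mu>" using e by (simp add: gaussian_entry_def)
  have finT: "finite T" if "T \<in> hi_supports N n s \<sigma>" for T
    using hi_supports_subset[OF that] by (rule finite_subset) simp
  have finI: "finite I" unfolding I_def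
    by (intro finite_SigmaI finite_hi_supports finite_lattice_net finT)
  have ev: "bad T f \<in> sets P" if "T \<in> hi_supports N n s \<sigma>" for T f
  proof -
    have [measurable]: "(\<lambda>A. quad_defect m T (\<lambda>i k. e (A (i, k))) (gauss_int f)) \<in> borel_measurable P"
      unfolding P_def M_def iid_entries_def
      by (rule quad_defect_measurable[OF em hi_supports_subset[OF that]])
    show ?thesis unfolding bad_def by measurable
  qed
  have pr: "measure P (bad T f) \<le> q" if "T \<in> hi_supports N n s \<sigma>" for T f
    unfolding bad_def P_def M_def iid_entries_def q_def
    using \<delta> by (intro quad_defect_tail[OF e _ hi_supports_subset[OF that]]) (auto simp: t_def)
  have cI: "real (card I) \<le> real (card (hi_supports N n s \<sigma>)) * 2304 ^ (s * \<sigma>)"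
  proof -
    have "real (card I) = (\<Sum>T\<in>hi_supports N n s \<sigma>. real (card (lattice_net T (8 * card T))))"
      unfolding I_def by (subst card_SigmaI) (auto simp: finite_hi_supports finite_lattice_net finT)
    also have "\<dots> \<le> (\<Sum>T\<in>hi_supports N n s \<sigma>. 2304 ^ (s * \<sigma>))"
    proof (intro sum_mono)
      fix T assume T: "T \<in> hi_supports N n s \<sigma>"
      have "real (card (lattice_net T (8 * card T))) \<le> 2 ^ (8 * card T) * 9 ^ card T"
        by (rule card_lattice_net[OF finT[OF T]])
      also have "\<dots> = (2304::real) ^ card T" by (simp add: power_mult power_mult_distrib[symmetric])
      also have "\<dots> \<le> 2304 ^ (s * \<sigma>)" using card_hi_support_le[OF T] by (intro power_increasing) auto
      finally show "real (card (lattice_net T (8 * card T))) \<le> 2304 ^ (s * \<sigma>)" .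
    qed
    finally show ?thesis by simp
  qed
  have "measure P B \<le> (\<Sum>p\<in>I. measure P (bad (fst p) (snd p)))"
    unfolding B_def by (intro measure_UNION_le finI ev) (auto simp: I_def)
  also have "\<dots> \<le> (\<Sum>p\<in>I. q)" by (intro sum_mono pr) (auto simp: I_def)
  also have "\<dots> = real (card I) * 4 * exp (- (t\<^sup>2 * m / 16))" by (simp add: q_def)
  also have "\<dots> \<le> exp (16 * (real s * ln (real N / real s) + real s * real \<sigma> * ln (exp 1 * real n / real \<sigma>)))
      * exp (- (t\<^sup>2 * m / 16))"
    using cI card_hi_supports_net_le[OF s \<sigma>] by (intro mult_right_mono) auto
  \<comment> \<open>The tail exponent t^2 m / 16 equals \<delta>^2 m / 64 and has to dominate 16
    times the bracket in the condition on m; hence the constant 1024 = 64 * 16.\<close>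
  also have "\<dots> \<le> exp (- (16 * ln (1 / \<epsilon>)))"
  proof -
    have "1024 * (real s * ln (real N / real s)
      + real s * real \<sigma> * ln (exp 1 * real n / real \<sigma>) + ln (1 / \<epsilon>)) \<le> \<delta>\<^sup>2 * real m"
      using large \<delta> by (simp add: pos_divide_le_eq mult_ac)
    moreover have "t\<^sup>2 * m / 16 = \<delta>\<^sup>2 * real m / 64" by (simp add: t_def power_divide)
    ultimately show ?thesis
      unfolding exp_add[symmetric] exp_le_cancel_iff distrib_left by linarith
  qed
  also have "\<dots> \<le> exp (- ln (1 / \<epsilon>))"
  proof -
    have "0 \<le> ln (1 / \<epsilon>)" using \<epsilon> by (intro ln_ge_zero) simp
    then show ?thesis unfolding exp_le_cancel_iff by linarith
  qed
  also have "\<dots> = \<epsilon>" using \<epsilon> by (simp add: ln_div)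
  finally have "measure P B \<le> \<epsilon>" .
  moreover have "B \<in> sets P" unfolding B_def
    by (intro sets.finite_UN finI ev) (auto simp: I_def)
  moreover have "hirip_bound N n s \<sigma> (complex_of_real (1 / sqrt (real m)) \<cdot>\<^sub>m Matrix.mat m (N * n) (\<lambda>p. e (A p))) \<delta>"
    if A: "A \<in> space P - B" for A
  proof (rule hirip_bound_of_quad_defect[OF s(2) \<sigma>(2) m])
    fix T x assume T: "T \<in> hi_supports N n s \<sigma>"
    have "\<bar>quad_defect m T (\<lambda>i k. e (A (i, k))) x\<bar> \<le> 2 * (t * real m) * (\<Sum>k\<in>T. (cmod (x k))\<^sup>2)"
    proof (rule quad_defect_le_of_net[OF finT[OF T]])
      show "0 \<le> t * real m" using \<delta> by (simp add: t_def)
      fix f assume "f \<in> lattice_net T (8 * card T)"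
      then have "(T, f) \<in> I" using T by (simp add: I_def)
      then have "A \<notin> bad T f" using A by (fastforce simp: B_def)
      then show "\<bar>quad_defect m T (\<lambda>i k. e (A (i, k))) (gauss_int f)\<bar>
          \<le> t * real m * (\<Sum>k\<in>T. (cmod (gauss_int f k))\<^sup>2)"
        using A by (simp add: bad_def mult.assoc)
    qed
    then show "\<bar>quad_defect m T (\<lambda>i k. e (A (i, k))) x\<bar> \<le> \<delta> * real m * (\<Sum>k\<in>T. (cmod (x k))\<^sup>2)"
      by (simp add: t_def)
  qed
  ultimately show ?thesis unfolding P_def by blast
qed

lemma (in prob_space) prob_ge_one_minus:
  assumes "B \<in> events" "prob B \<le> \<epsilon>" "{A \<in> space M. Q A} \<in> events"
    and Q: "\<And>A. A \<in> space M - B \<Longrightarrow> Q A"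
  shows "1 - \<epsilon> \<le> prob {A \<in> space M. Q A}"
proof -
  have "1 - \<epsilon> \<le> prob (space M - B)" using assms by (simp add: prob_compl)
  also have "\<dots> \<le> prob {A \<in> space M. Q A}"
    using assms by (intro finite_measure_mono) auto
  finally show ?thesis .
qed

(* The second logarithm is ln (e n / \<sigma>) rather than ln (n / \<sigma>): with ln (n / \<sigma>) and s = N, \<sigma> = n
   the bound would not depend on N n, and the claim fails as soon as m < N n, where A has a kernel. *)
theorem theorem2:
  shows "\<exists>C>0. \<forall>(N::nat) (n::nat) (m::nat) (s::nat) (\<sigma>::nat) (\<delta>::real) (\<epsilon>::real).
    0 < N \<longrightarrow> 0 < n \<longrightarrow> 0 < m \<longrightarrow> 1 \<le> s \<longrightarrow> s \<le> N \<longrightarrow> 1 \<le> \<sigma> \<longrightarrow> \<sigma> \<le> n \<longrightarrow>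
    0 < \<delta> \<longrightarrow> \<delta> < 1 \<longrightarrow> 0 < \<epsilon> \<longrightarrow> \<epsilon> < 1 \<longrightarrow>
    real m \<ge> C / \<delta>\<^sup>2 * (real s * ln (real N / real s)
      + real s * real \<sigma> * ln (exp 1 * real n / real \<sigma>) + ln (1 / \<epsilon>)) \<longrightarrow>
    \<P>(A in iid_entries std_normal m (N * n).
        hirip_const N n s \<sigma> ((1 / sqrt (real m)) \<cdot>\<^sub>m Matrix.mat m (N * n) A) \<le> \<delta>) \<ge> 1 - \<epsilon> \<and>
    (\<forall>\<mu> \<in> {std_normal_of_real, complex_std_normal}.
      \<P>(A in iid_entries \<mu> m (N * n).
        hirip_const N n s \<sigma> (complex_of_real (1 / sqrt (real m)) \<cdot>\<^sub>m Matrix.mat m (N * n) A) \<le> \<delta>)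
      \<ge> 1 - \<epsilon>)"
proof (intro exI[of _ 1024] conjI allI impI ballI)
  fix N n m s \<sigma> :: nat and \<delta> \<epsilon> :: real
  assume m: "0 < m" and s: "1 \<le> s" "s \<le> N" and \<sigma>: "1 \<le> \<sigma>" "\<sigma> \<le> n"
    and \<delta>: "0 < \<delta>" "\<delta> < 1" and \<epsilon>: "0 < \<epsilon>" "\<epsilon> < 1"
    and large: "real m \<ge> 1024 / \<delta>\<^sup>2 * (real s * ln (real N / real s)
      + real s * real \<sigma> * ln (exp 1 * real n / real \<sigma>) + ln (1 / \<epsilon>))"
  note exceptional = gaussian_hirip_exceptional_set[OF _ m s \<sigma> \<delta> \<epsilon> large]
  have prob: "prob_space (iid_entries \<mu> m (N * n))" if "prob_space \<mu>" for \<mu> :: "'c measure"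
    unfolding iid_entries_def by (rule prob_space_PiM) (rule that)
  have \<delta>0: "0 \<le> \<delta>" using \<delta> by simp
  show "1 - \<epsilon> \<le> \<P>(A in iid_entries std_normal m (N * n).
        hirip_const N n s \<sigma> ((1 / sqrt (real m)) \<cdot>\<^sub>m Matrix.mat m (N * n) A) \<le> \<delta>)"
  proof -
    interpret prob_space "iid_entries std_normal m (N * n)" by (rule prob[OF prob_space_std_normal])
    obtain B where B: "B \<in> events" "prob B \<le> \<epsilon>"
      and hirip: "\<And>A. A \<in> space (iid_entries std_normal m (N * n)) - B \<Longrightarrow> hirip_bound N n s \<sigma>
        (complex_of_real (1 / sqrt (real m)) \<cdot>\<^sub>m Matrix.mat m (N * n) (\<lambda>p. complex_of_real (A p))) \<delta>"
      using exceptional[OF gaussian_entry_of_real] by blast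
    show ?thesis
    proof (rule prob_ge_one_minus[OF B])
      show "{A \<in> space (iid_entries std_normal m (N * n)).
          hirip_const N n s \<sigma> ((1 / sqrt (real m)) \<cdot>\<^sub>m Matrix.mat m (N * n) A) \<le> \<delta>} \<in> events"
        by (rule sets_hirip_const_le[OF _ \<delta>0]) (simp add: std_normal_def)
      fix A assume "A \<in> space (iid_entries std_normal m (N * n)) - B"
      then show "hirip_const N n s \<sigma> ((1 / sqrt (real m)) \<cdot>\<^sub>m Matrix.mat m (N * n) A) \<le> \<delta>"
        by (subst hirip_const_le_iff[where m = m]) (simp_all add: \<delta>0 hirip_bound_of_real hirip del: of_real_divide)
    qed
  qed
  fix \<mu> assume "\<mu> \<in> {std_normal_of_real, complex_std_normal}"
  then have e: "gaussian_entry \<mu> (\<lambda>z. z)" and b: "sets \<mu> = sets borel"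
    using gaussian_entry_distr[OF gaussian_entry_of_real] gaussian_entry_distr[OF gaussian_entry_complex_pair]
    by (auto simp: std_normal_of_real_def complex_std_normal_def)
  interpret prob_space "iid_entries \<mu> m (N * n)"
    using e by (intro prob) (simp add: gaussian_entry_def)
  obtain B where B: "B \<in> events" "prob B \<le> \<epsilon>"
    and hirip: "\<And>A. A \<in> space (iid_entries \<mu> m (N * n)) - B \<Longrightarrow> hirip_bound N n s \<sigma>
      (complex_of_real (1 / sqrt (real m)) \<cdot>\<^sub>m Matrix.mat m (N * n) A) \<delta>"
    using exceptional[OF e] by auto
  show "1 - \<epsilon> \<le> \<P>(A in iid_entries \<mu> m (N * n).
        hirip_const N n s \<sigma> (complex_of_real (1 / sqrt (real m)) \<cdot>\<^sub>m Matrix.mat m (N * n) A) \<le> \<delta>)"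
  proof (rule prob_ge_one_minus[OF B sets_hirip_const_le[OF b \<delta>0]])
    fix A assume "A \<in> space (iid_entries \<mu> m (N * n)) - B"
    then show "hirip_const N n s \<sigma> (complex_of_real (1 / sqrt (real m)) \<cdot>\<^sub>m Matrix.mat m (N * n) A) \<le> \<delta>"
      using hirip by (subst hirip_const_le_iff[where m = m]) (simp_all add: \<delta>0)
  qed
qed simp

end
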